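(* Let $(G,q_1)$ and $(\Gamma,q_2)$ be metric groups with $|G|$ even, $|\Gamma|$ odd, $c:=\mathcal{G}(q_1)=-\mathcal{G}(q_2)$, $|\Gamma|=|G|+1$, and $K:=G_2=\{g\in G:2g=0\}\cong\mathbb{Z}_2\times\mathbb{Z}_2$. With $J$, $N$, $\nu_m$ as in the context, for all $m\in\mathbb{N}$, $(k,\varepsilon)\in J_1$, $g\in G_*$, $\gamma\in\Gamma_*$: $$\nu_m(\pi)=|\mathcal{G}(q_1,m)+\mathcal{G}(q_2,m)|^2,$$ $$\nu_m((k,\varepsilon))=\frac{|\mathcal{G}(q_1,m)+\mathcal{G}(q_2,m)|^2+\delta_{mk,0}\,q_1(k)^m}{2},$$ $$\nu_m(g)=|\mathcal{G}(q_1,m)+\mathcal{G}(q_2,m)|^2+\delta_{mg,0}\,q_1(g)^m,$$ $$\nu_m(\gamma)=|\mathcal{G}(q_1,m)+\mathcal{G}(q_2,m)|^2-\delta_{m\gamma,0}\,q_2(\gamma)^m.$$ In particular: (a) the condition (FS2), that for every $x\in J$ one has $\nu_2(x)=0$ if $x\ne\overline x$ and $\nu_2(x)\in\{1,-1\}$ if $x=\overline x$, is equivalent to $|\mathcal{G}(q_1,2)+\mathcal{G}(q_2,2)|=1$; (b) the condition (FS3), that for every $x\in J$ the number $\nu_3(x)$ is a sum of $N_{x,x,x}$ numbers belonging to $\{1,e^{2\pi i/3},e^{4\pi i/3}\}$, is equivalent to $|\mathcal{G}(q_1,3)+\mathcal{G}(q_2,3)|=2$.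
   Context: A metric group $(G,q)$ is a finite abelian group $G$ with a map $q:G\to\mathbb{T}=\{z\in\mathbb{C}:|z|=1\}$ such that $q(-g)=q(g)$ and $\langle g,h\rangle=q(g+h)q(g)^{-1}q(h)^{-1}$ is a non-degenerate bicharacter. $\mathcal{G}(q,m)=\frac{1}{\sqrt{|G|}}\sum_{g\in G}q(g)^m$, $\mathcal{G}(q)=\mathcal{G}(q,1)$. Let $a=1/\sqrt{|G|}$, $b=1/\sqrt{|\Gamma|}$. Fix $G_*\subset G$, $\Gamma_*\subset\Gamma$ with $G=K\sqcup G_*\sqcup(-G_* )$, $\Gamma=\{0\}\sqcup\Gamma_*\sqcup(-\Gamma_* )$. Let $J_1=(K\setminus\{0\})\times\{1,-1\}$ and $J=\{0,\pi\}\sqcup J_1\sqcup G_*\sqcup\Gamma_*$. Involution on $J$: $\overline{(k,\varepsilon)}=(k,c^2\langle k,k\rangle\varepsilon)$ for $(k,\varepsilon)\in J_1$ (here $c^2\in\{1,-1\}$), all other elements fixed. With blocks indexed in order by $\{0\},\{\pi\},J_1,G_*,\Gamma_*$ (rows $0,\pi,(k,\varepsilon),g,\gamma$; columns with primes): $$S=\begin{pmatrix} \frac{a-b}{2}&\frac{a+b}{2}&\frac{a}{2}&a&b\\ \frac{a+b}{2}&\frac{a-b}{2}&\frac{a}{2}&a&-b\\ \frac{a}{2}&\frac{a}{2}&\frac{a\langle k,k'\rangle+c\varepsilon\varepsilon'q_1(k)\delta_{k,k'}}{2}&a\langle k,g'\rangle&0\\ a&a&a\langle g,k'\rangle&a(\langle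 g,g'\rangle+\overline{\langle g,g'\rangle})&0\\ b&-b&0&0&-b(\langle\gamma,\gamma'\rangle+\overline{\langle\gamma,\gamma'\rangle}) \end{pmatrix},$$ $T=\mathrm{Diag}(1,1,q_1(k),q_1(g),q_2(\gamma))$. Further $N_{x,y,z}=\sum_{w\in J}S_{w,x}S_{w,y}S_{w,z}/S_{0,w}$, $N_{x,y}^z=N_{x,y,\overline z}$, and $\nu_m(z)=\sum_{x,y\in J}N_{x,y}^z\,S_{0,x}S_{0,y}(T_{y,y}/T_{x,x})^m$. *)

theory Defs
  imports "HOL-Analysis.Analysis" "HOL-Library.Z2"
begin

text \<open>
  A finite abelian group is a type of sort \<open>{finite, ab_group_add}\<close>. The circle group
  is the set of complex numbers of modulus 1.
\<close>

definition pairing :: "('g::ab_group_add \<Rightarrow> complex) \<Rightarrow> 'g \<Rightarrow> 'g \<Rightarrow> complex" where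
  "pairing q g h = q (g + h) * inverse (q g) * inverse (q h)"

definition bicharacter :: "('g::ab_group_add \<Rightarrow> 'g \<Rightarrow> complex) \<Rightarrow> bool" where
  "bicharacter b \<longleftrightarrow>
     (\<forall>g h. cmod (b g h) = 1) \<and>
     (\<forall>g g' h. b (g + g') h = b g h * b g' h) \<and>
     (\<forall>g h h'. b g (h + h') = b g h * b g h')"

definition nondegenerate :: "('g::ab_group_add \<Rightarrow> 'g \<Rightarrow> complex) \<Rightarrow> bool" where
  "nondegenerate b \<longleftrightarrow>
     (\<forall>g. (\<forall>h. b g h = 1) \<longrightarrow> g = 0) \<and>
     (\<forall>h. (\<forall>g. b g h = 1) \<longrightarrow> h = 0)"

definition metric_group :: "('g::{finite,ab_group_add} \<Rightarrow> complex) \<Rightarrow> bool" where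
  "metric_group q \<longleftrightarrow>
     (\<forall>g. cmod (q g) = 1) \<and> (\<forall>g. q (- g) = q g) \<and>
     bicharacter (pairing q) \<and> nondegenerate (pairing q)"

definition gauss :: "('g::{finite,ab_group_add} \<Rightarrow> complex) \<Rightarrow> nat \<Rightarrow> complex" where
  "gauss q m = 1 / of_real (sqrt (real CARD('g))) * (\<Sum>g\<in>UNIV. q g ^ m)"

primrec nmul :: "nat \<Rightarrow> 'g::ab_group_add \<Rightarrow> 'g" where
  "nmul 0 g = 0"
| "nmul (Suc n) g = g + nmul n g"

definition two_torsion :: "'g::ab_group_add set" where
  "two_torsion = {g. nmul 2 g = 0}"

definition is_klein_four :: "'g::ab_group_add set \<Rightarrow> bool" where
  "is_klein_four K \<longleftrightarrow>
     (\<exists>\<phi> :: bit \<times> bit \<Rightarrow> 'g. bij_betw \<phi> UNIV K \<and> (\<forall>x y. \<phi> (x + y) = \<phi> x + \<phi> y))"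

text \<open>The whole group is the disjoint union of \<open>K\<close>, \<open>A\<close> and \<open>- A\<close>.\<close>
definition half_system :: "'g::ab_group_add set \<Rightarrow> 'g set \<Rightarrow> bool" where
  "half_system K A \<longleftrightarrow>
     UNIV = K \<union> A \<union> uminus ` A \<and>
     K \<inter> A = {} \<and> K \<inter> uminus ` A = {} \<and> A \<inter> uminus ` A = {}"

text \<open>
  Labels for the index set \<open>J\<close>. The sign \<open>\<epsilon>\<close> is a complex number, so that the involution and
  the entries of \<open>S\<close> need no coercions; \<open>index_set\<close> restricts it to 1 and -1.
\<close>
datatype ('g, 'h) label = LZero | LPi | LK 'g complex | LG 'g | LGamma 'h

definition J1 :: "('g::ab_group_add \<times> complex) set" where
  "J1 = (two_torsion - {0}) \<times> {1, -1}"

definition index_set :: "'g::ab_group_add set \<Rightarrow> 'h set \<Rightarrow> ('g, 'h) label set" where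
  "index_set Gs \<Gamma>s = {LZero, LPi} \<union> (\<lambda>(k, \<epsilon>). LK k \<epsilon>) ` J1 \<union> LG ` Gs \<union> LGamma ` \<Gamma>s"

fun invol :: "complex \<Rightarrow> ('g::ab_group_add \<Rightarrow> complex) \<Rightarrow> ('g, 'h) label \<Rightarrow> ('g, 'h) label" where
  "invol c q1 (LK k \<epsilon>) = LK k (c\<^sup>2 * pairing q1 k k * \<epsilon>)"
| "invol c q1 x = x"

fun S_entry :: "complex \<Rightarrow> complex \<Rightarrow> complex \<Rightarrow> ('g::ab_group_add \<Rightarrow> complex) \<Rightarrow>
    ('h::ab_group_add \<Rightarrow> complex) \<Rightarrow> ('g, 'h) label \<Rightarrow> ('g, 'h) label \<Rightarrow> complex" where
  "S_entry a b c q1 q2 LZero LZero = (a - b) / 2"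
| "S_entry a b c q1 q2 LZero LPi = (a + b) / 2"
| "S_entry a b c q1 q2 LZero (LK k' \<epsilon>') = a / 2"
| "S_entry a b c q1 q2 LZero (LG g') = a"
| "S_entry a b c q1 q2 LZero (LGamma \<gamma>') = b"
| "S_entry a b c q1 q2 LPi LZero = (a + b) / 2"
| "S_entry a b c q1 q2 LPi LPi = (a - b) / 2"
| "S_entry a b c q1 q2 LPi (LK k' \<epsilon>') = a / 2"
| "S_entry a b c q1 q2 LPi (LG g') = a"
| "S_entry a b c q1 q2 LPi (LGamma \<gamma>') = - b"
| "S_entry a b c q1 q2 (LK k \<epsilon>) LZero = a / 2"
| "S_entry a b c q1 q2 (LK k \<epsilon>) LPi = a / 2"
| "S_entry a b c q1 q2 (LK k \<epsilon>) (LK k' \<epsilon>') =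
     (a * pairing q1 k k' + (if k = k' then c * \<epsilon> * \<epsilon>' * q1 k else 0)) / 2"
| "S_entry a b c q1 q2 (LK k \<epsilon>) (LG g') = a * pairing q1 k g'"
| "S_entry a b c q1 q2 (LK k \<epsilon>) (LGamma \<gamma>') = 0"
| "S_entry a b c q1 q2 (LG g) LZero = a"
| "S_entry a b c q1 q2 (LG g) LPi = a"
| "S_entry a b c q1 q2 (LG g) (LK k' \<epsilon>') = a * pairing q1 g k'"
| "S_entry a b c q1 q2 (LG g) (LG g') = a * (pairing q1 g g' + cnj (pairing q1 g g'))"
| "S_entry a b c q1 q2 (LG g) (LGamma \<gamma>') = 0"
| "S_entry a b c q1 q2 (LGamma \<gamma>) LZero = b"
| "S_entry a b c q1 q2 (LGamma \<gamma>) LPi = - b"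
| "S_entry a b c q1 q2 (LGamma \<gamma>) (LK k' \<epsilon>') = 0"
| "S_entry a b c q1 q2 (LGamma \<gamma>) (LG g') = 0"
| "S_entry a b c q1 q2 (LGamma \<gamma>) (LGamma \<gamma>') =
     - b * (pairing q2 \<gamma> \<gamma>' + cnj (pairing q2 \<gamma> \<gamma>'))"

definition S_mat :: "complex \<Rightarrow> ('g::{finite,ab_group_add} \<Rightarrow> complex) \<Rightarrow>
    ('h::{finite,ab_group_add} \<Rightarrow> complex) \<Rightarrow> ('g, 'h) label \<Rightarrow> ('g, 'h) label \<Rightarrow> complex" where
  "S_mat c q1 q2 =
     S_entry (of_real (1 / sqrt (real CARD('g)))) (of_real (1 / sqrt (real CARD('h)))) c q1 q2"

fun T_diag :: "('g \<Rightarrow> complex) \<Rightarrow> ('h \<Rightarrow> complex) \<Rightarrow> ('g, 'h) label \<Rightarrow> complex" where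
  "T_diag q1 q2 LZero = 1"
| "T_diag q1 q2 LPi = 1"
| "T_diag q1 q2 (LK k \<epsilon>) = q1 k"
| "T_diag q1 q2 (LG g) = q1 g"
| "T_diag q1 q2 (LGamma \<gamma>) = q2 \<gamma>"

definition T_mat :: "('g \<Rightarrow> complex) \<Rightarrow> ('h \<Rightarrow> complex) \<Rightarrow> ('g, 'h) label \<Rightarrow> ('g, 'h) label \<Rightarrow> complex"
  where "T_mat q1 q2 x y = (if x = y then T_diag q1 q2 x else 0)"

text \<open>The coefficients with three lower indices; one upper index \<open>z\<close> means a lower index \<open>invol z\<close>.\<close>
definition N3 :: "complex \<Rightarrow> ('g::{finite,ab_group_add} \<Rightarrow> complex) \<Rightarrow>
    ('h::{finite,ab_group_add} \<Rightarrow> complex) \<Rightarrow> 'g set \<Rightarrow> 'h set \<Rightarrow>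
    ('g, 'h) label \<Rightarrow> ('g, 'h) label \<Rightarrow> ('g, 'h) label \<Rightarrow> complex" where
  "N3 c q1 q2 Gs \<Gamma>s x y z =
     (\<Sum>w\<in>index_set Gs \<Gamma>s.
        S_mat c q1 q2 w x * S_mat c q1 q2 w y * S_mat c q1 q2 w z / S_mat c q1 q2 LZero w)"

definition Nup :: "complex \<Rightarrow> ('g::{finite,ab_group_add} \<Rightarrow> complex) \<Rightarrow>
    ('h::{finite,ab_group_add} \<Rightarrow> complex) \<Rightarrow> 'g set \<Rightarrow> 'h set \<Rightarrow>
    ('g, 'h) label \<Rightarrow> ('g, 'h) label \<Rightarrow> ('g, 'h) label \<Rightarrow> complex" where
  "Nup c q1 q2 Gs \<Gamma>s x y z = N3 c q1 q2 Gs \<Gamma>s x y (invol c q1 z)"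

definition fs_indicator :: "complex \<Rightarrow> ('g::{finite,ab_group_add} \<Rightarrow> complex) \<Rightarrow>
    ('h::{finite,ab_group_add} \<Rightarrow> complex) \<Rightarrow> 'g set \<Rightarrow> 'h set \<Rightarrow>
    nat \<Rightarrow> ('g, 'h) label \<Rightarrow> complex" where
  "fs_indicator c q1 q2 Gs \<Gamma>s m z =
     (\<Sum>x\<in>index_set Gs \<Gamma>s. \<Sum>y\<in>index_set Gs \<Gamma>s.
        Nup c q1 q2 Gs \<Gamma>s x y z * S_mat c q1 q2 LZero x * S_mat c q1 q2 LZero y *
        (T_mat q1 q2 y y / T_mat q1 q2 x x) ^ m)"

definition FS2 :: "complex \<Rightarrow> ('g::{finite,ab_group_add} \<Rightarrow> complex) \<Rightarrow>
    ('h::{finite,ab_group_add} \<Rightarrow> complex) \<Rightarrow> 'g set \<Rightarrow> 'h set \<Rightarrow> bool" where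
  "FS2 c q1 q2 Gs \<Gamma>s \<longleftrightarrow>
     (\<forall>x\<in>index_set Gs \<Gamma>s.
        (x \<noteq> invol c q1 x \<longrightarrow> fs_indicator c q1 q2 Gs \<Gamma>s 2 x = 0) \<and>
        (x = invol c q1 x \<longrightarrow> fs_indicator c q1 q2 Gs \<Gamma>s 2 x \<in> {1, -1}))"

text \<open>
  Being a sum of \<open>N\<^bsub>x,x,x\<^esub>\<close> numbers presupposes that this complex number is a natural number;
  this is part of the condition.
\<close>
definition FS3 :: "complex \<Rightarrow> ('g::{finite,ab_group_add} \<Rightarrow> complex) \<Rightarrow>
    ('h::{finite,ab_group_add} \<Rightarrow> complex) \<Rightarrow> 'g set \<Rightarrow> 'h set \<Rightarrow> bool" where
  "FS3 c q1 q2 Gs \<Gamma>s \<longleftrightarrow>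
     (\<forall>x\<in>index_set Gs \<Gamma>s. \<exists>n::nat.
        N3 c q1 q2 Gs \<Gamma>s x x x = of_nat n \<and>
        (\<exists>\<omega> :: nat \<Rightarrow> complex.
           (\<forall>i<n. \<omega> i \<in> {1, exp (2 * of_real pi * \<i> / 3), exp (4 * of_real pi * \<i> / 3)}) \<and>
           fs_indicator c q1 q2 Gs \<Gamma>s 3 x = (\<Sum>i<n. \<omega> i)))"

end

theory Submission
  imports Defs
begin

text \<open>
  Expanding the fusion coefficients gives \<open>\<nu>\<^sub>m(z) = \<Sum>\<^sub>w (S\<^sub>w\<^sub>z / S\<^sub>0\<^sub>w) |A\<^sub>w|\<^sup>2\<close> with
  \<open>A\<^sub>w = \<Sum>\<^sub>y S\<^sub>w\<^sub>y S\<^sub>0\<^sub>y T\<^sub>y\<^sup>m\<close>. Up to scalars the \<open>A\<^sub>w\<close> are the values of the Fourier transforms of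
  \<open>q\<^sub>1\<^sup>m\<close> and \<open>q\<^sub>2\<^sup>m\<close>, and the Fourier transform of \<open>|A|\<^sup>2\<close> is the autocorrelation of \<open>q\<^sup>m\<close>, which is
  \<open>|G| q(u)\<^sup>m\<close> if \<open>m u = 0\<close> and vanishes otherwise; \<open>1/b\<^sup>2 - 1/a\<^sup>2 = 1\<close> does the rest.
  For the two equivalences one also needs \<open>c\<^sup>2 = 1\<close>. It holds because \<open>4\<close> divides \<open>|G|\<close>, so
  \<open>|\<Gamma>| \<equiv> 1 (mod 4)\<close>. If \<open>|G(q\<^sub>1,3) + G(q\<^sub>2,3)| = 2\<close>, then \<open>\<nu>\<^sub>3(x) = N\<^sub>x\<^sub>x\<^sub>x\<close> for all \<open>x\<close>; conversely
  \<open>\<nu>\<^sub>3((k,\<epsilon>))\<close> is a nonnegative real sum of two cube roots of unity, hence equal to 2.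
\<close>

section \<open>Gauss sums of metric groups\<close>

text \<open>The operator \<open>T\<close> with kernel \<open>K\<close> is self-adjoint and
  idempotent, hence an orthogonal projection, and its trace is the dimension of its range.\<close>

lemma trace_idempotent_kernel:
  fixes K :: "'n::finite \<Rightarrow> 'n \<Rightarrow> real"
  assumes sym: "\<And>x y. K x y = K y x"
    and idem: "\<And>x z. (\<Sum>y\<in>UNIV. K x y * K y z) = K x z"
  shows "(\<Sum>x\<in>UNIV. K x x) \<in> \<nat>"
proof -
  define T :: "real^'n \<Rightarrow> real^'n" where "T v = (\<chi> x. \<Sum>y\<in>UNIV. K x y * v $ y)" for v
  have lin: "linear T"
    by (rule linearI) (simp_all add: T_def vec_eq_iff algebra_simps sum.distrib sum_distrib_left)
  have TT: "T (T v) = T v" for v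
  proof -
    have "(\<Sum>y\<in>UNIV. K x y * (\<Sum>z\<in>UNIV. K y z * v $ z)) = (\<Sum>z\<in>UNIV. K x z * v $ z)" for x
    proof -
      have "(\<Sum>y\<in>UNIV. K x y * (\<Sum>z\<in>UNIV. K y z * v $ z))
          = (\<Sum>z\<in>UNIV. (\<Sum>y\<in>UNIV. K x y * K y z) * v $ z)"
        unfolding sum_distrib_left sum_distrib_right by (subst sum.swap) (simp add: mult_ac)
      then show ?thesis by (simp add: idem)
    qed
    then show ?thesis by (simp add: T_def)
  qed
  have adj: "T v \<bullet> w = v \<bullet> T w" for v w
  proof -
    have "T v \<bullet> w = (\<Sum>x\<in>UNIV. \<Sum>y\<in>UNIV. K x y * v $ y * w $ x)"
      by (simp add: T_def inner_vec_def sum_distrib_right)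
    also have "\<dots> = (\<Sum>y\<in>UNIV. \<Sum>x\<in>UNIV. v $ y * (K y x * w $ x))"
      by (subst sum.swap) (simp add: sym mult_ac)
    finally show ?thesis by (simp add: T_def inner_vec_def sum_distrib_left)
  qed
  obtain E where E: "E \<subseteq> range T" "pairwise orthogonal E" "\<And>x. x \<in> E \<Longrightarrow> norm x = 1"
      "independent E" "card E = dim (range T)" "span E = range T"
    using orthonormal_basis_subspace[OF linear_subspace_image[OF lin subspace_UNIV]] by metis
  have fin: "finite E"
    using E(4) by (rule independent_imp_finite)
  have TE: "T e = e" if "e \<in> E" for e
    using E(1) that TT by auto
  \<comment> \<open>\<open>T v\<close> lies in the span of \<open>E\<close>; since \<open>T\<close>
    is self-adjoint and fixes \<open>E\<close>, its coefficients can be read off from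
    \<open>v\<close> itself.\<close>
  have expand: "T v = (\<Sum>e\<in>E. (v \<bullet> e) *\<^sub>R e)" for v
  proof -
    have "T v \<in> span E" by (simp add: E(6))
    then have "T v = (\<Sum>e\<in>E. (T v \<bullet> e) *\<^sub>R e)"
      by (simp add: orthonormal_basis_expand[OF E(2,3) _ fin])
    also have "\<dots> = (\<Sum>e\<in>E. (v \<bullet> e) *\<^sub>R e)"
      by (intro sum.cong refl) (simp add: adj TE)
    finally show ?thesis .
  qed
  have "(\<Sum>x\<in>UNIV. K x x) = (\<Sum>x\<in>UNIV. T (axis x 1) $ x)"
    by (simp add: T_def axis_def if_distrib cong: if_cong)
  also have "\<dots> = (\<Sum>x\<in>UNIV. \<Sum>e\<in>E. e $ x * e $ x)"
    by (simp add: expand inner_axis_axis inner_axis')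
  also have "\<dots> = (\<Sum>e\<in>E. e \<bullet> e)"
    by (subst sum.swap) (simp add: inner_vec_def)
  also have "\<dots> = of_nat (card E)"
    using E(3) by (simp add: dot_square_norm)
  finally show ?thesis by simp
qed

lemma cnj_eq_inverse: "cmod z = 1 \<Longrightarrow> cnj z = inverse z"
  using complex_norm_square[of z] by (simp add: inverse_unique)

lemma sum_translate: "(\<Sum>x\<in>UNIV. f (x + y)) = (\<Sum>x\<in>UNIV. f x)"
  for y :: "'g::{finite,ab_group_add}"
  by (rule sum.reindex_bij_witness[of _ "\<lambda>x. x - y" "\<lambda>x. x + y"]) auto

lemma sum_minus: "(\<Sum>x\<in>UNIV. f (- x)) = (\<Sum>x\<in>UNIV. f x)"
  for f :: "'g::{finite,ab_group_add} \<Rightarrow> 'a::comm_monoid_add"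
  by (rule sum.reindex_bij_witness[of _ uminus uminus]) auto

lemma nmul_zero [simp]: "nmul m 0 = 0"
  by (induction m) simp_all

section \<open>Metric groups and their pairing\<close>

locale quad_group =
  fixes q :: "'g::{finite,ab_group_add} \<Rightarrow> complex"
  assumes metric: "metric_group q"
begin

abbreviation B where "B \<equiv> pairing q"

lemma norm_q [simp]: "cmod (q x) = 1"
  and q_minus [simp]: "q (- x) = q x"
  and norm_B [simp]: "cmod (B x y) = 1"
  and B_add_left: "B (x + x') y = B x y * B x' y"
  and B_add_right: "B x (y + y') = B x y * B x y'"
  using metric unfolding metric_group_def bicharacter_def by blast+

lemma q_nonzero [simp]: "q x \<noteq> 0"
  using norm_q[of x] by (metis norm_zero zero_neq_one)

lemma B_nonzero [simp]: "B x y \<noteq> 0"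
  using norm_B[of x y] by (metis norm_zero zero_neq_one)

lemma B_commute: "B x y = B y x"
  by (simp add: pairing_def add.commute mult.commute mult.left_commute)

lemma q_add: "q (x + y) = q x * q y * B x y"
  by (simp add: pairing_def field_simps)

lemma B_zero [simp]: "B 0 y = 1" "B y 0 = 1"
  using B_add_left[of 0 0 y] B_add_right[of y 0 0] by simp_all

lemma q_zero [simp]: "q 0 = 1"
  using q_add[of 0 0] by simp

lemma B_minus_left: "B (- x) y = cnj (B x y)"
  using B_add_left[of x "- x" y] cnj_eq_inverse[OF norm_B, of x y]
  by (simp add: inverse_unique)

lemma B_minus_right: "B x (- y) = cnj (B x y)"
  using B_minus_left[of y x] by (simp add: B_commute)

text \<open>Evaluate \<open>q\<close> at \<open>x + (- x) = 0\<close>: evenness turns the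
  polarization formula into \<open>q x ^ 2 * cnj (B x x) = 1\<close>.\<close>

lemma q_square: "q x ^ 2 = B x x"
proof -
  have "1 = q x * q x * cnj (B x x)"
    using q_add[of x "- x"] by (simp add: B_minus_right)
  then show ?thesis
    using cnj_eq_inverse[OF norm_B, of x x] by (simp add: field_simps power2_eq_square)
qed

lemma B_nmul: "B (nmul m x) y = B x y ^ m" "B x (nmul m y) = B x y ^ m"
  by (induction m) (simp_all add: B_add_left B_add_right)

text \<open>For \<open>y\<close> nonzero, translation by some \<open>z\<close> with
  \<open>B z y\<close> different from 1 multiplies the sum by \<open>B z y\<close>, so the sum
  vanishes.\<close>

lemma sum_B: "(\<Sum>x\<in>UNIV. B x y) = (if y = 0 then of_nat CARD('g) else 0)"
proof (cases "y = 0")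
  case False
  then obtain z where z: "B z y \<noteq> 1"
    using metric unfolding metric_group_def nondegenerate_def by blast
  have "(\<Sum>x\<in>UNIV. B x y) = (\<Sum>x\<in>UNIV. B (x + z) y)"
    by (rule sum_translate[symmetric])
  also have "\<dots> = B z y * (\<Sum>x\<in>UNIV. B x y)"
    by (simp add: B_add_left sum_distrib_left mult.commute)
  finally show ?thesis
    using z False by auto
qed simp

text \<open>The square of \<open>q x ^ m\<close> is \<open>B (nmul m x) x = 1\<close>, so the power
  is its own inverse, and on the unit circle the inverse is the conjugate.\<close>

lemma torsion_power_real:
  assumes "nmul m x = 0"
  shows "cnj (q x ^ m) = q x ^ m"
proof -
  have "q x ^ m * q x ^ m = B (nmul m x) x"
    by (simp add: B_nmul q_square[symmetric] power_mult_distrib[symmetric] power2_eq_square)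
  then have "q x ^ m * q x ^ m = 1"
    using assms by simp
  moreover have "cmod (q x ^ m) = 1"
    by (simp add: norm_power)
  ultimately show ?thesis
    by (metis cnj_eq_inverse inverse_unique)
qed

text \<open>Compare \<open>q (x + x) = q x ^ 4\<close> with \<open>q (- x) = q x\<close>. This makes
  the torsion terms of the third indicators plain integers.\<close>

lemma torsion_three:
  assumes "nmul 3 x = 0"
  shows "q x ^ 3 = 1"
proof -
  have "x + x = - x"
    using assms by (simp add: numeral_3_eq_3 eq_neg_iff_add_eq_0 add.assoc)
  then have "q x * q x * q x ^ 2 = q x"
    using q_add[of x x] q_square[of x] by simp
  then show ?thesis
    by (simp add: power2_eq_square power3_eq_cube mult.assoc)
qed

section \<open>Fourier transform and power spectrum\<close>

definition transform :: "('g \<Rightarrow> complex) \<Rightarrow> 'g \<Rightarrow> complex" where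
  "transform t h = (\<Sum>g\<in>UNIV. B h g * t g) / of_real (sqrt (real CARD('g)))"

lemma transform_cnj:
  assumes "\<And>x. t (- x) = t x"
  shows "transform (\<lambda>x. cnj (t x)) h = cnj (transform t h)"
proof -
  have "(\<Sum>g\<in>UNIV. B h g * cnj (t g)) = (\<Sum>g\<in>UNIV. B h (- g) * cnj (t (- g)))"
    using sum_minus[of "\<lambda>g. B h g * cnj (t g)"] by simp
  then show ?thesis
    by (simp add: transform_def assms B_minus_right)
qed

lemma transform_minus:
  assumes "\<And>x. t (- x) = t x"
  shows "transform t (- h) = transform t h"
proof -
  have "(\<Sum>g\<in>UNIV. B (- h) g * t g) = (\<Sum>g\<in>UNIV. B (- h) (- g) * t (- g))"
    using sum_minus[of "\<lambda>g. B (- h) g * t g"] by simp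
  then show ?thesis
    by (simp add: transform_def assms B_minus_right B_minus_left)
qed

lemma transform_0: "transform (\<lambda>x. q x ^ m) 0 = gauss q m"
  by (simp add: transform_def gauss_def)

definition spectrum :: "nat \<Rightarrow> 'g \<Rightarrow> complex" where
  "spectrum m h = transform (\<lambda>x. q x ^ m) h * cnj (transform (\<lambda>x. q x ^ m) h)"

lemma spectrum_minus [simp]: "spectrum m (- h) = spectrum m h"
  by (simp add: spectrum_def transform_minus)

lemma spectrum_0: "spectrum m 0 = gauss q m * cnj (gauss q m)"
  by (simp add: spectrum_def transform_0)

text \<open>Summing the expanded square over \<open>h\<close> first keeps only
  \<open>y = x + u\<close>. What remains is a constant times the character
  \<open>B x (- nmul m u)\<close> of \<open>x\<close>, whose sum vanishes unless
  \<open>nmul m u = 0\<close>.\<close>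

lemma spectrum_transform:
  "(\<Sum>h\<in>UNIV. spectrum m h * B h u) =
    of_nat CARD('g) * (if nmul m u = 0 then q u ^ m else 0)"
proof -
  let ?n = "of_nat CARD('g) :: complex"
  have n: "?n \<noteq> 0" by simp
  have r: "complex_of_real (sqrt (real CARD('g))) * complex_of_real (sqrt (real CARD('g))) = ?n"
    by (metis of_real_mult of_real_of_nat_eq real_sqrt_mult_self abs_of_nat)
  have "spectrum m h * B h u = (\<Sum>x\<in>UNIV. \<Sum>y\<in>UNIV.
      q x ^ m * cnj (q y ^ m) * B h (x - y + u)) / ?n" for h
  proof -
    have "spectrum m h = (\<Sum>x\<in>UNIV. \<Sum>y\<in>UNIV. (B h x * q x ^ m) * cnj (B h y * q y ^ m)) / ?n"
      unfolding spectrum_def transform_def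
      by (simp add: sum_product r)
    then show ?thesis
      by (simp add: sum_distrib_left sum_distrib_right B_add_right B_minus_right mult_ac
          diff_conv_add_uminus del: add_uminus_conv_diff)
  qed
  then have "(\<Sum>h\<in>UNIV. spectrum m h * B h u) = (\<Sum>h\<in>UNIV. \<Sum>x\<in>UNIV. \<Sum>y\<in>UNIV.
      q x ^ m * cnj (q y ^ m) * B h (x - y + u)) / ?n"
    by (simp add: sum_divide_distrib)
  also have "(\<Sum>h\<in>UNIV. \<Sum>x\<in>UNIV. \<Sum>y\<in>UNIV. q x ^ m * cnj (q y ^ m) * B h (x - y + u))
      = (\<Sum>x\<in>UNIV. \<Sum>y\<in>UNIV. q x ^ m * cnj (q y ^ m) * (\<Sum>h\<in>UNIV. B h (x - y + u)))"
    unfolding sum_distrib_left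
    by (rule trans[OF sum.swap], rule sum.cong[OF refl], rule sum.swap)
  also have "\<dots> = (\<Sum>x\<in>UNIV. \<Sum>y\<in>UNIV. if y = x + u then q x ^ m * cnj (q y ^ m) * ?n else 0)"
    by (intro sum.cong refl) (auto simp: sum_B algebra_simps)
  also have "\<dots> = (\<Sum>x\<in>UNIV. q x ^ m * cnj (q (x + u) ^ m)) * ?n"
    by (simp add: sum_distrib_right)
  also have "(\<Sum>x\<in>UNIV. q x ^ m * cnj (q (x + u) ^ m)) = (\<Sum>x\<in>UNIV. cnj (q u ^ m) * B x (- nmul m u))"
  proof (intro sum.cong refl)
    fix x
    have "q x ^ m * cnj (q x ^ m) = 1"
      by (metis complex_norm_square norm_power norm_q of_real_1 power_one)
    then show "q x ^ m * cnj (q (x + u) ^ m) = cnj (q u ^ m) * B x (- nmul m u)"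
      by (simp add: q_add power_mult_distrib B_minus_right B_nmul mult_ac)
  qed
  also have "\<dots> = (if nmul m u = 0 then cnj (q u ^ m) * ?n else 0)"
    unfolding sum_distrib_left[symmetric] sum_B by simp
  \<comment> \<open>The computation ends with the conjugate of \<open>q u ^ m\<close>; on
    \<open>m\<close>-torsion this power is real.\<close>
  finally show ?thesis
    using n torsion_power_real[of m u] by simp
qed

text \<open>Completing the square gives the transform of \<open>q\<close> at \<open>h\<close> as
  \<open>cnj (q h) * gauss q 1\<close>, so the spectrum is constant. Its total is the group order,
  so the constant is 1.\<close>

lemma gauss_1_norm: "gauss q 1 * cnj (gauss q 1) = 1"
proof -
  have "transform (\<lambda>x. q x ^ 1) h = cnj (q h) * gauss q 1" for h
  proof -
    have "B h g * q g ^ 1 = cnj (q h) * q (g + h)" for g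
      using cnj_eq_inverse[OF norm_q, of h] by (simp add: q_add B_commute field_simps)
    then have "(\<Sum>g\<in>UNIV. B h g * q g ^ 1) = cnj (q h) * (\<Sum>g\<in>UNIV. q g)"
      using sum_translate[of q h] by (simp add: sum_distrib_left[symmetric])
    then show ?thesis
      by (simp add: transform_def gauss_def)
  qed
  then have "spectrum 1 h = gauss q 1 * cnj (gauss q 1)" for h
    using cnj_eq_inverse[OF norm_q, of h] by (simp add: spectrum_def mult_ac)
  then show ?thesis
    using spectrum_transform[of 1 0] by simp
qed

text \<open>Without 2-torsion the substitution \<open>(u + v, u - v)\<close> is a bijection of
  pairs, and the mixed pairings cancel in \<open>q (u + v) * q (u - v)\<close>.\<close>

lemma gauss_1_square:
  assumes odd: "\<And>x :: 'g. x + x = 0 \<Longrightarrow> x = 0"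
  shows "gauss q 1 ^ 2 = gauss q 2 ^ 2"
proof -
  let ?f = "\<lambda>(u, v). (u + v, u - v :: 'g)"
  have inj: "inj ?f"
  proof (rule injI, clarify)
    fix u v u' v' :: 'g
    assume uv: "u + v = u' + v'" "u - v = u' - v'"
    have "u + u = (u + v) + (u - v)" "u' + u' = (u' + v') + (u' - v')"
      by (simp_all add: add_diff_eq)
    with uv have "u + u = u' + u'" by metis
    then have "(u - u') + (u - u') = 0" by (simp add: add_diff_add[symmetric])
    then have "u - u' = 0" by (rule odd)
    then have "u = u'" by simp
    with uv show "u = u' \<and> v = v'" by simp
  qed
  then have bij: "bij ?f"
    by (simp add: bij_def finite_UNIV_inj_surj)
  have "(\<Sum>x\<in>UNIV. q x) ^ 2 = (\<Sum>(x, y)\<in>UNIV. q x * q y)"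
    by (simp add: power2_eq_square sum_product sum.cartesian_product)
  also have "\<dots> = (\<Sum>(u, v)\<in>UNIV. q (u + v) * q (u - v))"
    using sum.reindex_bij_betw[OF bij, of "\<lambda>(x, y). q x * q y", symmetric]
    by (simp add: case_prod_beta)
  also have "\<dots> = (\<Sum>(u, v)\<in>UNIV. q u ^ 2 * q v ^ 2)"
  proof (intro sum.cong refl, clarify)
    fix u v
    have "B u v * cnj (B u v) = 1"
      by (metis complex_norm_square norm_B of_real_1 power_one)
    then show "q (u + v) * q (u - v) = q u ^ 2 * q v ^ 2"
      using q_add[of u v] q_add[of u "- v"]
      by (simp add: B_minus_right power2_eq_square mult_ac)
  qed
  also have "\<dots> = (\<Sum>x\<in>UNIV. q x ^ 2) ^ 2"
    by (simp add: power2_eq_square sum_product sum.cartesian_product)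
  finally show ?thesis
    by (simp add: gauss_def power_mult_distrib power_divide)
qed

text \<open>
  The sine kernel squares to the projection onto odd functions, so twice the idempotent below has
  trace \<open>(n - 1) / 2 + Im (gauss q 2)\<close>; integrality of the trace then excludes a nonzero
  imaginary part.
\<close>
lemma gauss_1_square_eq_1:
  assumes odd: "\<And>x :: 'g. x + x = 0 \<Longrightarrow> x = 0"
    and mod4: "CARD('g) mod 4 = 1"
  shows "gauss q 1 ^ 2 = 1"
proof -
  let ?n = "real CARD('g)"
  have n: "?n > 0" by simp
  have sq: "sqrt ?n * sqrt ?n = ?n" by simp
  define s where "s x y = Im (B x y) / sqrt ?n" for x y
  define d :: "'g \<Rightarrow> 'g \<Rightarrow> real" where "d x y = (of_bool (y = x) - of_bool (y = - x)) / 2" for x y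
  \<comment> \<open>As \<open>s\<close> squares to \<open>d\<close> and kills even functions,
    \<open>(d + s) / 2\<close> is the projection onto the eigenspace of \<open>s\<close> for the
    eigenvalue 1.\<close>
  define K where "K x y = (d x y + s x y) / 2" for x y
  have s_sym: "s x y = s y x" for x y by (simp add: s_def B_commute)
  have d_sym: "d x y = d y x" for x y by (auto simp: d_def)
  have s_minus: "s (- x) y = - s x y" "s x (- y) = - s x y" for x y
    by (simp_all add: s_def B_minus_left B_minus_right)
  have d_minus: "d (- x) y = - d x y" for x y by (simp add: d_def)
  have dl: "(\<Sum>y\<in>UNIV. d x y * f y) = (f x - f (- x)) / 2" for x and f :: "'g \<Rightarrow> real"
    by (simp add: d_def sum_divide_distrib[symmetric] left_diff_distrib sum_subtractf)
  have ss: "(\<Sum>y\<in>UNIV. s x y * s y z) = d x z" for x z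
  proof -
    \<comment> \<open>Writing imaginary parts through conjugates turns the product into four
      characters of \<open>y\<close>, each summed by orthogonality.\<close>
    have im: "complex_of_real (Im w) = - (\<i> * (w - cnj w)) / 2" for w
      by (simp add: complex_eq_iff)
    have "complex_of_real (Im (B x y) * Im (B y z))
        = (B y (x + - z) + B y (- x + z) - B y (x + z) - B y (- x + - z)) / 4" for y
      unfolding of_real_mult im B_commute[of x y] B_add_right B_minus_right
      by (simp add: algebra_simps)
    then have "complex_of_real (\<Sum>y\<in>UNIV. Im (B x y) * Im (B y z))
        = (\<Sum>y\<in>UNIV. B y (x + - z) + B y (- x + z) - B y (x + z) - B y (- x + - z)) / 4"
      by (simp only: of_real_sum sum_divide_distrib)
    also have "\<dots> = complex_of_real (?n * d x z)"
    proof -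
      have "x + - z = 0 \<longleftrightarrow> z = x" "- x + z = 0 \<longleftrightarrow> z = x" "x + z = 0 \<longleftrightarrow> z = - x"
        "- x + - z = 0 \<longleftrightarrow> z = - x"
        by (auto simp: add_eq_0_iff)
      then show ?thesis
        unfolding sum.distrib sum_subtractf sum_B by (simp add: d_def)
    qed
    finally have "(\<Sum>y\<in>UNIV. Im (B x y) * Im (B y z)) = ?n * d x z"
      using of_real_eq_iff by blast
    then show ?thesis
      using n by (simp add: s_def sum_divide_distrib[symmetric])
  qed
  have "(\<Sum>x\<in>UNIV. K x x) \<in> \<nat>"
  proof (rule trace_idempotent_kernel[of K])
    show "K x y = K y x" for x y by (simp add: K_def s_sym d_sym)
    fix x z
    have "(\<Sum>y\<in>UNIV. K x y * K y z)
        = ((\<Sum>y\<in>UNIV. d x y * d y z) + (\<Sum>y\<in>UNIV. d x y * s y z) + (\<Sum>y\<in>UNIV. d z y * s y x)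
          + (\<Sum>y\<in>UNIV. s x y * s y z)) / 4"
      by (simp add: K_def sum.distrib[symmetric] sum_divide_distrib algebra_simps s_sym d_sym)
    also have "\<dots> = K x z"
      by (simp add: dl ss d_minus s_minus K_def s_sym[of z x])
    finally show "(\<Sum>y\<in>UNIV. K x y * K y z) = K x z" .
  qed
  then obtain r where r: "(\<Sum>x\<in>UNIV. K x x) = of_nat r"
    by (auto elim: Nats_cases)
  \<comment> \<open>At \<open>x = 0\<close> the two terms of \<open>d x x\<close> cancel; every
    other diagonal entry is 1/2.\<close>
  have "x = - x \<longleftrightarrow> x = 0" for x :: 'g
    using odd[of x] by (auto simp: eq_neg_iff_add_eq_0)
  then have "(\<Sum>x\<in>UNIV. d x x) = (?n - 1) / 2"
    by (simp add: d_def sum_divide_distrib[symmetric] sum_subtractf of_bool_def)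
  moreover have "(\<Sum>x\<in>UNIV. s x x) = Im (gauss q 2)"
    by (simp add: s_def gauss_def q_square sum_divide_distrib Im_divide_of_real)
  ultimately have tr: "2 * of_nat r = (?n - 1) / 2 + Im (gauss q 2)"
    using r by (simp add: K_def sum.distrib sum_divide_distrib[symmetric] field_simps)
  \<comment> \<open>With order \<open>4 * k + 1\<close> the trace formula makes
    \<open>Im (gauss q 2)\<close> the even integer \<open>2 * (r - k)\<close>; since it is at most 1
    in absolute value, it is 0.\<close>
  obtain k where k: "CARD('g) = 4 * k + 1"
    using mod4 by (metis mult_div_mod_eq)
  have "cmod (gauss q 1) ^ 2 = 1"
    using gauss_1_norm by (metis complex_norm_square of_real_eq_1_iff)
  then have norm: "cmod (gauss q 2) ^ 2 = 1"
    using gauss_1_square[OF odd] by (metis norm_power)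
  then have "\<bar>Im (gauss q 2)\<bar> \<le> 1"
    using abs_Im_le_cmod[of "gauss q 2"] norm_ge_zero[of "gauss q 2"]
    by (auto simp: power2_eq_1_iff)
  moreover have "Im (gauss q 2) = of_int (2 * (int r - int k))"
    using tr k by simp
  ultimately have "\<bar>2 * (int r - int k)\<bar> \<le> 1"
    by linarith
  then have "Im (gauss q 2) = 0"
    using \<open>Im (gauss q 2) = of_int _\<close> by simp
  then have "gauss q 2 = of_real (Re (gauss q 2))"
    by (simp add: complex_eq_iff)
  then have "gauss q 2 ^ 2 = 1"
    using norm by (metis norm_of_real of_real_1 of_real_power power2_abs)
  then show ?thesis
    using gauss_1_square[OF odd] by simp
qed

end

text \<open>The fibres of the doubling map over its range are translates of the 2-torsion subgroup,
  so they all have its size.\<close>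

lemma card_two_torsion_dvd:
  "card (two_torsion :: 'g::{finite,ab_group_add} set) dvd CARD('g)"
proof -
  let ?d = "\<lambda>x :: 'g. x + x"
  have "card {x. ?d x = y} = card (two_torsion :: 'g set)" if y: "y \<in> range ?d" for y
  proof -
    obtain z where z: "y = z + z" using y by blast
    have "bij_betw (\<lambda>x. x + z) two_torsion {x. ?d x = y}"
      by (rule bij_betw_byWitness[of _ "\<lambda>x. x - z"])
        (auto simp: two_torsion_def numeral_2_eq_2 z algebra_simps)
    then show ?thesis by (metis bij_betw_same_card)
  qed
  moreover have "CARD('g) = (\<Sum>y\<in>range ?d. card {x. ?d x = y})"
    using sum.image_gen[of UNIV "\<lambda>_. 1 :: nat" ?d] by simp
  ultimately show ?thesis by simp
qed

lemma card_klein_four: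
  assumes "is_klein_four K"
  shows "card K = 4"
proof -
  have "CARD(bit) = 2"
  proof -
    have "(UNIV :: bit set) = {0, 1}" using bit_not_one_iff by auto
    then show ?thesis by (metis card_2_iff zero_neq_one)
  qed
  then show ?thesis
    using assms unfolding is_klein_four_def by (auto dest!: bij_betw_same_card)
qed

section \<open>The indicators\<close>

lemma half_system_sum:
  fixes \<phi> :: "'g::{finite,ab_group_add} \<Rightarrow> complex"
  assumes "half_system K A"
  shows "sum \<phi> UNIV = sum \<phi> K + (\<Sum>x\<in>A. \<phi> x + \<phi> (- x))"
proof -
  have "sum \<phi> UNIV = sum \<phi> (K \<union> (A \<union> uminus ` A))"
    using assms by (metis half_system_def sup_assoc)
  also have "\<dots> = sum \<phi> K + (sum \<phi> A + sum \<phi> (uminus ` A))"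
    using assms by (subst sum.union_disjoint) (auto simp: half_system_def sum.union_disjoint)
  also have "sum \<phi> (uminus ` A) = (\<Sum>x\<in>A. \<phi> (- x))"
    by (simp add: sum.reindex)
  finally show ?thesis by (simp add: sum.distrib)
qed

lemma two_torsion_minus: "k \<in> two_torsion \<Longrightarrow> - k = k"
  by (simp add: two_torsion_def numeral_2_eq_2 neg_eq_iff_add_eq_0)

lemma zero_in_two_torsion [simp]: "0 \<in> two_torsion"
  by (simp add: two_torsion_def numeral_2_eq_2)

text \<open>
  A label \<open>LG g\<close> or \<open>LGamma \<gamma>\<close> stands for a pair of opposite group elements and the two signs at \<open>k\<close>
  belong to one element, so sums over the index set become sums over the whole groups.
\<close>
lemma sum_index_set:
  fixes f :: "('g::{finite,ab_group_add}, 'h::{finite,ab_group_add}) label \<Rightarrow> complex"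
  assumes half: "half_system two_torsion Gs" "half_system {0} Hs"
    and K: "\<And>k. k \<in> two_torsion \<Longrightarrow> k \<noteq> 0 \<Longrightarrow> f (LK k 1) + f (LK k (- 1)) = \<phi> k"
    and G: "\<And>g. g \<in> Gs \<Longrightarrow> f (LG g) = \<phi> g + \<phi> (- g)"
    and H: "\<And>\<gamma>. f (LGamma \<gamma>) = \<psi> \<gamma> + \<psi> (- \<gamma>)"
  shows "sum f (index_set Gs Hs) =
    f LZero + f LPi + (sum \<phi> UNIV - \<phi> 0) + (sum \<psi> UNIV - \<psi> 0)"
proof -
  let ?K = "two_torsion - {0} :: 'g set"
  have "sum f ((\<lambda>(k, \<epsilon>). LK k \<epsilon>) ` J1) = (\<Sum>(k, \<epsilon>)\<in>?K \<times> {1, - 1}. f (LK k \<epsilon>))"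
    unfolding J1_def by (subst sum.reindex) (auto simp: inj_on_def case_prod_beta)
  also have "\<dots> = (\<Sum>k\<in>?K. \<Sum>\<epsilon>\<in>{1, - 1}. f (LK k \<epsilon>))"
    by (rule sum.cartesian_product[symmetric])
  also have "\<dots> = sum \<phi> ?K"
    by (intro sum.cong refl) (simp add: K)
  also have "\<dots> = sum \<phi> two_torsion - \<phi> 0"
    by (simp add: sum_diff1)
  finally have 1: "sum f ((\<lambda>(k, \<epsilon>). LK k \<epsilon>) ` J1) = sum \<phi> two_torsion - \<phi> 0" .
  have 2: "sum f (LG ` Gs) = (\<Sum>g\<in>Gs. \<phi> g + \<phi> (- g))"
    by (subst sum.reindex) (auto simp: inj_on_def G)
  have 3: "sum f (LGamma ` Hs) = (\<Sum>g\<in>Hs. \<psi> g + \<psi> (- g))"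
    by (subst sum.reindex) (auto simp: inj_on_def H)
  have fin: "finite (J1 :: ('g \<times> complex) set)" by (simp add: J1_def)
  let ?A = "{LZero, LPi} :: ('g, 'h) label set" and ?B = "(\<lambda>(k, \<epsilon>). LK k \<epsilon>) ` J1 :: ('g, 'h) label set"
  have "sum f (?A \<union> ?B \<union> LG ` Gs \<union> LGamma ` Hs) = sum f (?A \<union> ?B \<union> LG ` Gs) + sum f (LGamma ` Hs)"
    by (rule sum.union_disjoint) (auto simp: fin)
  also have "sum f (?A \<union> ?B \<union> LG ` Gs) = sum f (?A \<union> ?B) + sum f (LG ` Gs)"
    by (rule sum.union_disjoint) (auto simp: fin)
  also have "sum f (?A \<union> ?B) = sum f ?A + sum f ?B"
    by (rule sum.union_disjoint) (auto simp: fin)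
  finally have "sum f (index_set Gs Hs) = sum f ?A + sum f ?B + sum f (LG ` Gs) + sum f (LGamma ` Hs)"
    by (simp only: index_set_def)
  then show ?thesis
    unfolding 1 2 3 half_system_sum[OF half(1), of \<phi>] half_system_sum[OF half(2), of \<psi>]
    by simp
qed

text \<open>The scalar identities to which the indicators reduce: \<open>x\<close>, \<open>y\<close>
  are the Gauss sums, \<open>x'\<close>, \<open>y'\<close> their conjugates, \<open>P\<close>,
  \<open>Q\<close> the intensities at \<open>LZero\<close> and \<open>LPi\<close>, and
  \<open>s\<close> the torsion term. The long factors are the reciprocals of
  \<open>(a - b) / 2\<close> and \<open>(a + b) / 2\<close>.\<close>

lemma indicator_identities:
  fixes a b n x y x' y' s :: complex
  assumes aan: "a * a * n = 1" and bbn: "b * b * (n + 1) = 1"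
  defines "P \<equiv> (a * x + b * y) * (a * x' + b * y') / 4"
    and "Q \<equiv> (a * x - b * y) * (a * x' - b * y') / 4"
  shows "P + Q + (a * a / 2 * n - a * a / 2 * (x * x'))
      + (b * b / 2 * (n + 1) - b * b / 2 * (y * y')) = 1" (is ?zero)
    and "(a + b) / 2 * (2 * (a + b) * (n * (n + 1))) * P + (a - b) / 2 * (2 * (a - b) * (n * (n + 1))) * Q
      + (a * a / 2 * n - a * a / 2 * (x * x')) + (- (b * b) / 2 * (n + 1) - - (b * b) / 2 * (y * y'))
      = (x + y) * (x' + y')" (is ?pi)
    and "a * (2 * (a + b) * (n * (n + 1))) * P + a * (2 * (a - b) * (n * (n + 1))) * Q
      + (a * a * (n * s) - a * a * (x * x')) + (0 - 0) = (x + y) * (x' + y') + s" (is ?g)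
    and "a / 2 * (2 * (a + b) * (n * (n + 1))) * P + a / 2 * (2 * (a - b) * (n * (n + 1))) * Q
      + (a * a / 2 * (n * s) - a * a / 2 * (x * x')) + (0 - 0) = ((x + y) * (x' + y') + s) / 2" (is ?k)
    and "b * (2 * (a + b) * (n * (n + 1))) * P + - b * (2 * (a - b) * (n * (n + 1))) * Q + (0 - 0)
      + (- (b * b) * ((n + 1) * s) - - (b * b) * (y * y')) = (x + y) * (x' + y') - s" (is ?gamma)
proof -
  have n: "n \<noteq> 0" "n + 1 \<noteq> 0" using aan bbn by auto
  have A: "a * a = 1 / n" and B: "b * b = 1 / (n + 1)"
    using aan bbn n by (simp_all add: eq_divide_eq)
  \<comment> \<open>\<open>u\<close> and \<open>a * b * v\<close> are the parts of
    \<open>4 * P\<close> kept and negated by \<open>b\<close> going to \<open>- b\<close>, which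
    exchanges \<open>P\<close> and \<open>Q\<close>. In this form every expression below involves
    \<open>a\<close> and \<open>b\<close> only through \<open>a * a\<close> and
    \<open>b * b\<close>.\<close>
  define u v where "u = (a * a) * (x * x') + (b * b) * (y * y')" and "v = x * y' + y * x'"
  have P: "4 * P = u + a * b * v" and Q: "4 * Q = u - a * b * v"
    by (simp_all add: P_def Q_def u_def v_def field_simps)
  have PQ: "P + Q = u / 2" "(a + b) * P + (a - b) * Q = (a * u + (a * b) * (b * v)) / 2"
    "(a + b) * P - (a - b) * Q = (b * u + (a * b) * (a * v)) / 2"
    using P Q by algebra+
  have PQ2: "(a + b) * (a + b) * P + (a - b) * (a - b) * Q = (a * a + b * b) * u / 2 + 2 * (a * a) * (b * b) * v / 2"
    using P Q by algebra
  show ?zero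
    unfolding PQ u_def A B using n by (simp add: divide_simps) algebra
  have z: "z / 2 * (2 * z * w) * p = w * (z * z * p)" for z w p :: complex
    by simp
  show ?pi
    unfolding z distrib_left[of "n * (n + 1)", symmetric] PQ2 u_def A B v_def
    using n by (simp add: divide_simps) algebra
  have "a * (2 * (a + b) * (n * (n + 1))) * P + a * (2 * (a - b) * (n * (n + 1))) * Q
    = 2 * (n * (n + 1)) * (a * ((a + b) * P + (a - b) * Q))" by (simp only: algebra_simps)
  also have "\<dots> = (n * (n + 1)) * (a * a * u + (a * a) * (b * b) * v)"
    unfolding PQ by (simp add: algebra_simps)
  finally have e: "a * (2 * (a + b) * (n * (n + 1))) * P + a * (2 * (a - b) * (n * (n + 1))) * Q
    = (n * (n + 1)) * (a * a * u + (a * a) * (b * b) * v)" .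
  show t2: ?g
    unfolding e u_def A B v_def using n by (simp add: divide_simps) algebra
  have half: "a / 2 * p * P + a / 2 * q * Q + (a * a / 2 * r - a * a / 2 * w) + (0 - 0)
    = (a * p * P + a * q * Q + (a * a * r - a * a * w) + (0 - 0)) / 2" for p q r w
    by (simp add: add_divide_distrib diff_divide_distrib)
  show ?k
    unfolding half t2 ..
  have "b * (2 * (a + b) * (n * (n + 1))) * P + - b * (2 * (a - b) * (n * (n + 1))) * Q
    = 2 * (n * (n + 1)) * (b * ((a + b) * P - (a - b) * Q))" by (simp add: algebra_simps)
  also have "\<dots> = (n * (n + 1)) * (b * b * u + (a * a) * (b * b) * v)"
    unfolding PQ by (simp add: algebra_simps)
  finally have e: "b * (2 * (a + b) * (n * (n + 1))) * P + - b * (2 * (a - b) * (n * (n + 1))) * Q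
    = (n * (n + 1)) * (b * b * u + (a * a) * (b * b) * v)" .
  show ?gamma
    unfolding e u_def A B v_def using n by (simp add: divide_simps) algebra
qed

text \<open>The counterpart for \<open>N3\<close> at three equal labels, with \<open>d\<close>
  standing for the indicator of 3-torsion. After expansion only even powers of \<open>a\<close> and
  \<open>b\<close> remain.\<close>

lemma fusion_identities:
  fixes a b n d :: complex
  assumes aan: "a * a * n = 1" and bbn: "b * b * (n + 1) = 1"
  shows "(a - b) / 2 * ((a - b) / 2) + (a + b) / 2 * ((a + b) / 2)
      + (n * (a * a / 2) - a * a / 2) + ((n + 1) * (b * b / 2) - b * b / 2) = 1" (is ?zero)
    and "((a + b) / 2) ^ 3 * (2 * (a + b) * (n * (n + 1))) + ((a - b) / 2) ^ 3 * (2 * (a - b) * (n * (n + 1)))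
      + (n * (a * a / 2) - a * a / 2) + ((n + 1) * (- (b * b) / 2) - - (b * b) / 2) = 4" (is ?pi)
    and "(a / 2) ^ 3 * (2 * (a + b) * (n * (n + 1))) + (a / 2) ^ 3 * (2 * (a - b) * (n * (n + 1)))
      + (3 / 2 - a * a / 2) = 2" (is ?k)
    and "a ^ 3 * (2 * (a + b) * (n * (n + 1))) + a ^ 3 * (2 * (a - b) * (n * (n + 1)))
      + (a * a * (n * d) - 4 * (a * a)) = 4 + d" (is ?g)
    and "b ^ 3 * (2 * (a + b) * (n * (n + 1))) + (- b) ^ 3 * (2 * (a - b) * (n * (n + 1)))
      + (- (b * b) * ((n + 1) * d) + 4 * (b * b)) = 4 - d" (is ?gamma)
proof -
  have n: "n \<noteq> 0" "n + 1 \<noteq> 0" using aan bbn by auto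
  have A: "a * a = 1 / n" and B: "b * b = 1 / (n + 1)"
    using aan bbn n by (simp_all add: eq_divide_eq)
  have e: "(a - b) / 2 * ((a - b) / 2) + (a + b) / 2 * ((a + b) / 2) = (a * a + b * b) / 2"
    "((a + b) / 2) ^ 3 * (2 * (a + b) * (n * (n + 1))) + ((a - b) / 2) ^ 3 * (2 * (a - b) * (n * (n + 1)))
      = (n * (n + 1)) * ((a * a) * (a * a) + 6 * (a * a) * (b * b) + (b * b) * (b * b)) / 2"
    "(a / 2) ^ 3 * (2 * (a + b) * (n * (n + 1))) + (a / 2) ^ 3 * (2 * (a - b) * (n * (n + 1)))
      = (n * (n + 1)) * ((a * a) * (a * a)) / 2"
    "a ^ 3 * (2 * (a + b) * (n * (n + 1))) + a ^ 3 * (2 * (a - b) * (n * (n + 1)))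
      = 4 * (n * (n + 1)) * ((a * a) * (a * a))"
    "b ^ 3 * (2 * (a + b) * (n * (n + 1))) + (- b) ^ 3 * (2 * (a - b) * (n * (n + 1)))
      = 4 * (n * (n + 1)) * ((b * b) * (b * b))"
    by (simp_all add: power3_eq_cube field_simps)
  show ?zero unfolding e A B using n by (simp add: divide_simps) algebra
  show ?pi unfolding e A B using n by (simp add: divide_simps) algebra
  show ?k unfolding e A B using n by (simp add: divide_simps)
  show ?g unfolding e A B using n by (simp add: divide_simps) algebra
  show ?gamma unfolding e A B using n by (simp add: divide_simps) algebra
qed

section \<open>The modular data and the first row of \<open>S\<close>\<close>

locale modular_pair = G: quad_group q1 + H: quad_group q2
  for q1 :: "'g::{finite,ab_group_add} \<Rightarrow> complex"
    and q2 :: "'h::{finite,ab_group_add} \<Rightarrow> complex" +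
  fixes Gs :: "'g set" and Hs :: "'h set" and c :: complex
  assumes card: "CARD('h) = CARD('g) + 1"
    and half_G: "half_system two_torsion Gs" and half_H: "half_system {0} Hs"
begin

definition a :: complex where "a = of_real (1 / sqrt (real CARD('g)))"
definition b :: complex where "b = of_real (1 / sqrt (real CARD('h)))"
definition n :: complex where "n = of_nat CARD('g)"

abbreviation "I \<equiv> index_set Gs Hs"
abbreviation "S \<equiv> S_entry a b c q1 q2"

lemma S_mat_eq: "S_mat c q1 q2 = S"
  by (simp add: S_mat_def a_def b_def)

lemmas sum_I = sum_index_set[OF half_G half_H]

lemma aan: "a * a * n = 1"
  and bbn: "b * b * (n + 1) = 1"
proof -
  have "r * r * complex_of_real x = 1" if "r = of_real (1 / sqrt x)" "x > 0" for r x
  proof -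
    have "r * r * complex_of_real x = of_real (1 / sqrt x * (1 / sqrt x) * x)"
      by (simp only: that(1) of_real_mult)
    also have "1 / sqrt x * (1 / sqrt x) * x = 1"
      using that by (simp add: field_simps)
    finally show ?thesis by simp
  qed
  from this[of a "real CARD('g)"] this[of b "real CARD('h)"]
  show "a * a * n = 1" "b * b * (n + 1) = 1"
    by (simp_all add: a_def b_def n_def card add.commute)
qed

lemma nonzero [simp]: "a \<noteq> 0" "b \<noteq> 0" "n \<noteq> 0" "n + 1 \<noteq> 0" "a + b \<noteq> 0" "a \<noteq> b"
proof -
  show 0: "a \<noteq> 0" "b \<noteq> 0" "n \<noteq> 0" "n + 1 \<noteq> 0"
    using aan bbn by auto
  have "a * a \<noteq> b * b"
  proof
    assume "a * a = b * b"
    with aan bbn have "a * a = 0" by algebra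
    with 0 show False by simp
  qed
  then show "a + b \<noteq> 0" "a \<noteq> b"
    by (auto simp: add_eq_0_iff)
qed

text \<open>Since \<open>(a * a - b * b) * (n * (n + 1)) = (n + 1) - n = 1\<close>, every first-row
  entry has a polynomial inverse, so divisions disappear before the identities are applied.\<close>

lemma divide_first_row:
  "x / ((a - b) / 2) = x * (2 * (a + b) * (n * (n + 1)))"
  "x / ((a + b) / 2) = x * (2 * (a - b) * (n * (n + 1)))"
  "x / (a / 2) = x * (2 * a * n)"
  "x / a = x * (a * n)"
  "x / b = x * (b * (n + 1))"
proof -
  have inv: "x / y = x * z" if "y * z = 1" for y z
  proof -
    have "z = inverse y" using that by (rule inverse_unique[symmetric])
    then show ?thesis by (simp add: divide_inverse)
  qed
  have d: "(a - b) * ((a + b) * (n * (n + 1))) = 1"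
    using aan bbn by algebra
  then show "x / ((a - b) / 2) = x * (2 * (a + b) * (n * (n + 1)))"
    by (intro inv) (simp add: mult_ac del: distrib_left_numeral right_diff_distrib_numeral)
  from d show "x / ((a + b) / 2) = x * (2 * (a - b) * (n * (n + 1)))"
    by (intro inv) (simp add: mult_ac del: distrib_left_numeral right_diff_distrib_numeral)
  show "x / (a / 2) = x * (2 * a * n)" "x / a = x * (a * n)" "x / b = x * (b * (n + 1))"
    by (rule inv, use aan bbn in \<open>simp add: mult.assoc\<close>)+
qed

section \<open>Amplitudes and intensities\<close>

definition amplitude :: "('g \<Rightarrow> complex) \<Rightarrow> ('h \<Rightarrow> complex) \<Rightarrow> ('g, 'h) label \<Rightarrow> complex" where
  "amplitude t1 t2 w = (\<Sum>y\<in>I. S w y * S LZero y * T_diag t1 t2 y)"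

lemma transform_eq: "G.transform t1 h = a * (\<Sum>g\<in>UNIV. G.B h g * t1 g)"
  "H.transform t2 \<gamma> = b * (\<Sum>g\<in>UNIV. H.B \<gamma> g * t2 g)"
  by (simp_all add: G.transform_def H.transform_def a_def b_def)

text \<open>The terms at \<open>LZero\<close> and \<open>LPi\<close> supply exactly the summands at
  the two group identities, so complete Fourier sums result. In row \<open>LK k \<epsilon>\<close>
  the terms with \<open>c\<close> cancel between the two signs.\<close>

lemma amplitude:
  assumes even: "\<And>x. t1 (- x) = t1 x" "\<And>x. t2 (- x) = t2 x" and t0: "t1 0 = 1" "t2 0 = 1"
  shows "amplitude t1 t2 LZero = (a * G.transform t1 0 + b * H.transform t2 0) / 2"
    and "amplitude t1 t2 LPi = (a * G.transform t1 0 - b * H.transform t2 0) / 2"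
    and "k \<in> two_torsion \<Longrightarrow> amplitude t1 t2 (LK k \<epsilon>) = a / 2 * G.transform t1 k"
    and "amplitude t1 t2 (LG g) = a * G.transform t1 g"
    and "amplitude t1 t2 (LGamma \<gamma>) = - b * H.transform t2 \<gamma>"
proof -
  have tG: "(\<Sum>g\<in>UNIV. a * x * (G.B h g * t1 g)) = x * G.transform t1 h" for h x
    by (simp add: transform_eq sum_distrib_left mult_ac)
  have tH: "(\<Sum>g\<in>UNIV. b * x * (H.B h g * t2 g)) = x * H.transform t2 h" for h x
    by (simp add: transform_eq sum_distrib_left mult_ac)
  have "amplitude t1 t2 LZero = S LZero LZero * S LZero LZero + S LZero LPi * S LZero LPi
      + ((\<Sum>h\<in>UNIV. a * (a / 2) * (G.B 0 h * t1 h)) - a * (a / 2) * (G.B 0 0 * t1 0))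
      + ((\<Sum>h\<in>UNIV. b * (b / 2) * (H.B 0 h * t2 h)) - b * (b / 2) * (H.B 0 0 * t2 0))"
    unfolding amplitude_def
    by (rule trans[OF sum_I[where \<phi> = "\<lambda>h. a * (a / 2) * (G.B 0 h * t1 h)"
          and \<psi> = "\<lambda>h. b * (b / 2) * (H.B 0 h * t2 h)"]])
      (simp_all add: even)
  also have "\<dots> = (a * G.transform t1 0 + b * H.transform t2 0) / 2"
    unfolding tG tH unfolding G.B_zero H.B_zero t0 S_entry.simps by (simp add: field_simps)
  finally show "amplitude t1 t2 LZero = (a * G.transform t1 0 + b * H.transform t2 0) / 2" .
  have "amplitude t1 t2 LPi = S LPi LZero * S LZero LZero + S LPi LPi * S LZero LPi
      + ((\<Sum>h\<in>UNIV. a * (a / 2) * (G.B 0 h * t1 h)) - a * (a / 2) * (G.B 0 0 * t1 0))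
      + ((\<Sum>h\<in>UNIV. b * (- b / 2) * (H.B 0 h * t2 h)) - b * (- b / 2) * (H.B 0 0 * t2 0))"
    unfolding amplitude_def
    by (rule trans[OF sum_I[where \<phi> = "\<lambda>h. a * (a / 2) * (G.B 0 h * t1 h)"
          and \<psi> = "\<lambda>h. b * (- b / 2) * (H.B 0 h * t2 h)"]])
      (simp_all add: even)
  also have "\<dots> = (a * G.transform t1 0 - b * H.transform t2 0) / 2"
    unfolding tG tH unfolding G.B_zero H.B_zero t0 S_entry.simps by (simp add: field_simps)
  finally show "amplitude t1 t2 LPi = (a * G.transform t1 0 - b * H.transform t2 0) / 2" .
  have "amplitude t1 t2 (LG g) = S (LG g) LZero * S LZero LZero + S (LG g) LPi * S LZero LPi
      + ((\<Sum>h\<in>UNIV. a * a * (G.B g h * t1 h)) - a * a * (G.B g 0 * t1 0))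
      + ((\<Sum>h\<in>UNIV. b * 0 * (H.B 0 h * t2 h)) - b * 0 * (H.B 0 0 * t2 0))"
    unfolding amplitude_def
    by (rule trans[OF sum_I[where \<phi> = "\<lambda>h. a * a * (G.B g h * t1 h)"
          and \<psi> = "\<lambda>h. b * 0 * (H.B 0 h * t2 h)"]])
      (simp_all add: even G.B_minus_right algebra_simps)
  also have "\<dots> = a * G.transform t1 g"
    unfolding tG tH unfolding G.B_zero H.B_zero t0 S_entry.simps by (simp add: field_simps)
  finally show "amplitude t1 t2 (LG g) = a * G.transform t1 g" .
  have "amplitude t1 t2 (LGamma \<gamma>) = S (LGamma \<gamma>) LZero * S LZero LZero + S (LGamma \<gamma>) LPi * S LZero LPi
      + ((\<Sum>h\<in>UNIV. a * 0 * (G.B 0 h * t1 h)) - a * 0 * (G.B 0 0 * t1 0))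
      + ((\<Sum>h\<in>UNIV. b * (- b) * (H.B \<gamma> h * t2 h)) - b * (- b) * (H.B \<gamma> 0 * t2 0))"
    unfolding amplitude_def
    by (rule trans[OF sum_I[where \<phi> = "\<lambda>h. a * 0 * (G.B 0 h * t1 h)"
          and \<psi> = "\<lambda>h. b * (- b) * (H.B \<gamma> h * t2 h)"]])
      (simp_all add: even H.B_minus_right algebra_simps)
  also have "\<dots> = - b * H.transform t2 \<gamma>"
    unfolding tG tH unfolding G.B_zero H.B_zero t0 S_entry.simps by (simp add: field_simps)
  finally show "amplitude t1 t2 (LGamma \<gamma>) = - b * H.transform t2 \<gamma>" .
  assume k: "k \<in> two_torsion"
  \<comment> \<open>Since \<open>k = - k\<close>, pairing with \<open>k\<close> is even, so the
    single entry at \<open>LG h\<close> can be shared equally by \<open>h\<close> and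
    \<open>- h\<close>.\<close>
  have [simp]: "G.B k (- h) = G.B k h" for h
    using G.B_minus_right[of k h] G.B_minus_left[of k h] two_torsion_minus[OF k] by simp
  have "amplitude t1 t2 (LK k \<epsilon>) = S (LK k \<epsilon>) LZero * S LZero LZero + S (LK k \<epsilon>) LPi * S LZero LPi
      + ((\<Sum>h\<in>UNIV. a * (a / 2) * (G.B k h * t1 h)) - a * (a / 2) * (G.B k 0 * t1 0))
      + ((\<Sum>h\<in>UNIV. b * 0 * (H.B 0 h * t2 h)) - b * 0 * (H.B 0 0 * t2 0))"
    unfolding amplitude_def
    by (rule trans[OF sum_I[where \<phi> = "\<lambda>h. a * (a / 2) * (G.B k h * t1 h)"
          and \<psi> = "\<lambda>h. b * 0 * (H.B 0 h * t2 h)"]])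
      (simp_all add: even field_simps)
  also have "\<dots> = a / 2 * G.transform t1 k"
    unfolding tG tH unfolding G.B_zero H.B_zero t0 S_entry.simps by (simp add: field_simps)
  finally show "amplitude t1 t2 (LK k \<epsilon>) = a / 2 * G.transform t1 k" .
qed

text \<open>On the index set this is the squared modulus of the amplitude, as the powers of
  \<open>q1\<close> and \<open>q2\<close> are even. The two factors come from the negative power of
  T at \<open>x\<close> and the positive one at \<open>y\<close>.\<close>

definition intensity :: "nat \<Rightarrow> ('g, 'h) label \<Rightarrow> complex" where
  "intensity m w = amplitude (\<lambda>x. cnj (q1 x ^ m)) (\<lambda>x. cnj (q2 x ^ m)) w
    * amplitude (\<lambda>x. q1 x ^ m) (\<lambda>x. q2 x ^ m) w"

lemma intensity:
  "intensity m LZero = (a * gauss q1 m + b * gauss q2 m) * (a * cnj (gauss q1 m) + b * cnj (gauss q2 m)) / 4"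
  "intensity m LPi = (a * gauss q1 m - b * gauss q2 m) * (a * cnj (gauss q1 m) - b * cnj (gauss q2 m)) / 4"
  "k \<in> two_torsion \<Longrightarrow> intensity m (LK k \<epsilon>) = a * a / 4 * G.spectrum m k"
  "intensity m (LG g) = a * a * G.spectrum m g"
  "intensity m (LGamma \<gamma>) = b * b * H.spectrum m \<gamma>"
proof -
  have t: "G.transform (\<lambda>x. cnj (q1 x ^ m)) h = cnj (G.transform (\<lambda>x. q1 x ^ m) h)"
    "H.transform (\<lambda>x. cnj (q2 x ^ m)) h' = cnj (H.transform (\<lambda>x. q2 x ^ m) h')" for h h'
    by (simp_all add: G.transform_cnj H.transform_cnj del: complex_cnj_power)
  note amp = amplitude[of "\<lambda>x. q1 x ^ m" "\<lambda>x. q2 x ^ m"]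
    amplitude[of "\<lambda>x. cnj (q1 x ^ m)" "\<lambda>x. cnj (q2 x ^ m)"]
  show "intensity m LZero = (a * gauss q1 m + b * gauss q2 m) * (a * cnj (gauss q1 m) + b * cnj (gauss q2 m)) / 4"
    "intensity m LPi = (a * gauss q1 m - b * gauss q2 m) * (a * cnj (gauss q1 m) - b * cnj (gauss q2 m)) / 4"
    "intensity m (LG g) = a * a * G.spectrum m g"
    "intensity m (LGamma \<gamma>) = b * b * H.spectrum m \<gamma>"
    by (simp_all add: intensity_def amp t G.transform_0 H.transform_0 G.spectrum_def H.spectrum_def
        mult.commute del: complex_cnj_power)
  show "intensity m (LK k \<epsilon>) = a * a / 4 * G.spectrum m k" if "k \<in> two_torsion"
    using that by (simp add: intensity_def amp t G.spectrum_def mult.commute del: complex_cnj_power)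
qed

lemma fs_indicator_eq:
  "fs_indicator c q1 q2 Gs Hs m z = (\<Sum>w\<in>I. S w (invol c q1 z) / S LZero w * intensity m w)"
proof -
  \<comment> \<open>On the unit circle inverses are conjugates, so the ratio splits into a factor in
    \<open>x\<close> and a factor in \<open>y\<close>; this decouples the double sum.\<close>
  have t: "(T_mat q1 q2 y y / T_mat q1 q2 x x) ^ m =
      T_diag (\<lambda>x. cnj (q1 x ^ m)) (\<lambda>x. cnj (q2 x ^ m)) x
      * T_diag (\<lambda>x. q1 x ^ m) (\<lambda>x. q2 x ^ m) y" for x y
  proof -
    have "cnj (q1 v) = inverse (q1 v)" "cnj (q2 v') = inverse (q2 v')" for v v'
      by (simp_all add: cnj_eq_inverse)
    then have "T_diag (\<lambda>x. cnj (q1 x ^ m)) (\<lambda>x. cnj (q2 x ^ m)) x = inverse (T_diag q1 q2 x) ^ m"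
      by (cases x) simp_all
    moreover have "T_diag (\<lambda>x. q1 x ^ m) (\<lambda>x. q2 x ^ m) y = T_diag q1 q2 y ^ m"
      by (cases y) simp_all
    ultimately show ?thesis
      by (simp add: T_mat_def power_mult_distrib divide_inverse mult.commute)
  qed
  let ?z = "invol c q1 z"
  have "fs_indicator c q1 q2 Gs Hs m z = (\<Sum>x\<in>I. \<Sum>y\<in>I. \<Sum>w\<in>I. S w ?z / S LZero w *
      ((S w x * S LZero x * T_diag (\<lambda>x. cnj (q1 x ^ m)) (\<lambda>x. cnj (q2 x ^ m)) x)
      * (S w y * S LZero y * T_diag (\<lambda>x. q1 x ^ m) (\<lambda>x. q2 x ^ m) y)))"
    unfolding fs_indicator_def Nup_def N3_def S_mat_eq t sum_distrib_right
    by (intro sum.cong refl) (simp add: mult_ac)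
  also have "\<dots> = (\<Sum>w\<in>I. \<Sum>x\<in>I. \<Sum>y\<in>I. S w ?z / S LZero w *
      ((S w x * S LZero x * T_diag (\<lambda>x. cnj (q1 x ^ m)) (\<lambda>x. cnj (q2 x ^ m)) x)
      * (S w y * S LZero y * T_diag (\<lambda>x. q1 x ^ m) (\<lambda>x. q2 x ^ m) y)))"
    by (rule trans[OF _ sum.swap], rule sum.cong[OF refl], rule sum.swap)
  also have "\<dots> = (\<Sum>w\<in>I. S w ?z / S LZero w * intensity m w)"
    unfolding intensity_def amplitude_def sum_product
    by (simp only: sum_distrib_left)
  finally show ?thesis .
qed

section \<open>Evaluation of the indicators label by label\<close>

definition X :: "nat \<Rightarrow> complex" where
  "X m = (gauss q1 m + gauss q2 m) * cnj (gauss q1 m + gauss q2 m)"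

lemma X_eq: "of_real ((cmod (gauss q1 m + gauss q2 m))\<^sup>2) = X m"
  by (simp only: X_def complex_norm_square)

lemma sum_spectrum:
  "(\<Sum>h\<in>UNIV. G.spectrum m h * G.B h u) = n * (if nmul m u = 0 then q1 u ^ m else 0)"
  "(\<Sum>h\<in>UNIV. H.spectrum m h * H.B h v) = (n + 1) * (if nmul m v = 0 then q2 v ^ m else 0)"
  by (simp_all add: G.spectrum_transform H.spectrum_transform n_def card add.commute)

lemma sum_spectrum_0:
  "(\<Sum>h\<in>UNIV. G.spectrum m h) = n" "(\<Sum>h\<in>UNIV. H.spectrum m h) = n + 1"
  using sum_spectrum(1)[of m 0] sum_spectrum(2)[of m 0] by simp_all

text \<open>Every ratio \<open>S w LZero / S LZero w\<close> is 1, so the indicator is the total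
  intensity. \<open>FS2\<close> and \<open>FS3\<close> also test this label.\<close>

lemma fs_LZero: "fs_indicator c q1 q2 Gs Hs m LZero = 1"
proof -
  have "fs_indicator c q1 q2 Gs Hs m LZero = intensity m LZero + intensity m LPi
     + ((\<Sum>g\<in>UNIV. a * a / 2 * G.spectrum m g) - a * a / 2 * G.spectrum m 0)
     + ((\<Sum>g\<in>UNIV. b * b / 2 * H.spectrum m g) - b * b / 2 * H.spectrum m 0)"
    unfolding fs_indicator_eq
    by (rule trans[OF sum_I[where \<phi> = "\<lambda>h. a * a / 2 * G.spectrum m h"
          and \<psi> = "\<lambda>h. b * b / 2 * H.spectrum m h"]])
      (simp_all add: intensity(3-5))
  also have "\<dots> = 1"
    unfolding sum_distrib_left[symmetric] sum_spectrum_0 G.spectrum_0 H.spectrum_0 intensity sum.neutral_const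
    by (rule indicator_identities[OF aan bbn])
  finally show ?thesis .
qed

text \<open>The ratio \<open>S w LPi / S LZero w\<close> is 1 on \<open>LK\<close> and
  \<open>LG\<close> and -1 on \<open>LGamma\<close>, so the spectra enter only through their totals
  and their values at 0.\<close>

lemma fs_LPi: "fs_indicator c q1 q2 Gs Hs m LPi = X m"
proof -
  have "fs_indicator c q1 q2 Gs Hs m LPi =
     (a + b) / 2 / ((a - b) / 2) * intensity m LZero + (a - b) / 2 / ((a + b) / 2) * intensity m LPi
     + ((\<Sum>g\<in>UNIV. a * a / 2 * G.spectrum m g) - a * a / 2 * G.spectrum m 0)
     + ((\<Sum>g\<in>UNIV. - (b * b) / 2 * H.spectrum m g) - - (b * b) / 2 * H.spectrum m 0)"
    unfolding fs_indicator_eq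
    by (rule trans[OF sum_I[where \<phi> = "\<lambda>h. a * a / 2 * G.spectrum m h"
          and \<psi> = "\<lambda>h. - (b * b) / 2 * H.spectrum m h"]])
      (simp_all add: intensity(3-5))
  also have "\<dots> = X m"
    unfolding sum_distrib_left[symmetric] sum_spectrum_0 G.spectrum_0 H.spectrum_0 intensity
      divide_first_row X_def complex_cnj_add sum.neutral_const
    by (rule indicator_identities[OF aan bbn])
  finally show ?thesis .
qed

text \<open>The \<open>LGamma\<close> labels drop out, and the remaining ones assemble to the
  Fourier transform of the spectrum at \<open>g\<close>, which produces the torsion term.\<close>

lemma fs_LG: "fs_indicator c q1 q2 Gs Hs m (LG g) =
    X m + (if nmul m g = 0 then q1 g ^ m else 0)"
proof -
  have "fs_indicator c q1 q2 Gs Hs m (LG g) =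
     a / ((a - b) / 2) * intensity m LZero + a / ((a + b) / 2) * intensity m LPi
     + ((\<Sum>h\<in>UNIV. a * a * (G.spectrum m h * G.B h g)) - a * a * (G.spectrum m 0 * G.B 0 g))
     + ((\<Sum>h\<in>(UNIV :: 'h set). 0) - 0)"
    unfolding fs_indicator_eq
    by (rule trans[OF sum_I[where \<phi> = "\<lambda>h. a * a * (G.spectrum m h * G.B h g)"
          and \<psi> = "\<lambda>h. 0"]])
      (simp_all add: intensity(3-5) G.B_minus_left algebra_simps add_divide_distrib diff_divide_distrib)
  also have "\<dots> = X m + (if nmul m g = 0 then q1 g ^ m else 0)"
    unfolding sum_distrib_left[symmetric] sum_spectrum G.spectrum_0 intensity
      divide_first_row X_def complex_cnj_add G.B_zero mult_1_right sum.neutral_const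
    by (rule indicator_identities[OF aan bbn])
  finally show ?thesis .
qed

text \<open>The terms with \<open>c\<close> carry the sign of the summation label and cancel in
  pairs, and with them the effect of the involution on \<open>\<epsilon>\<close>.\<close>

lemma fs_LK:
  assumes k: "k \<in> two_torsion"
  shows "fs_indicator c q1 q2 Gs Hs m (LK k \<epsilon>) =
    (X m + (if nmul m k = 0 then q1 k ^ m else 0)) / 2"
proof -
  have [simp]: "cnj (G.B h k) = G.B h k" for h
    using G.B_minus_right[of h k] two_torsion_minus[OF k] by simp
  have "fs_indicator c q1 q2 Gs Hs m (LK k \<epsilon>) =
     a / 2 / ((a - b) / 2) * intensity m LZero + a / 2 / ((a + b) / 2) * intensity m LPi
     + ((\<Sum>h\<in>UNIV. a * a / 2 * (G.spectrum m h * G.B h k)) - a * a / 2 * (G.spectrum m 0 * G.B 0 k))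
     + ((\<Sum>h\<in>(UNIV :: 'h set). 0) - 0)"
    unfolding fs_indicator_eq
    by (rule trans[OF sum_I[where \<phi> = "\<lambda>h. a * a / 2 * (G.spectrum m h * G.B h k)"
          and \<psi> = "\<lambda>h. 0"]])
      (simp_all add: intensity(3-5) G.B_minus_left algebra_simps add_divide_distrib diff_divide_distrib)
  also have "\<dots> = (X m + (if nmul m k = 0 then q1 k ^ m else 0)) / 2"
    unfolding sum_distrib_left[symmetric] sum_spectrum G.spectrum_0 intensity
      divide_first_row X_def complex_cnj_add G.B_zero mult_1_right sum.neutral_const
    by (rule indicator_identities[OF aan bbn])
  finally show ?thesis .
qed

lemma fs_LGamma: "fs_indicator c q1 q2 Gs Hs m (LGamma \<gamma>) =
    X m - (if nmul m \<gamma> = 0 then q2 \<gamma> ^ m else 0)"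
proof -
  have "fs_indicator c q1 q2 Gs Hs m (LGamma \<gamma>) =
     b / ((a - b) / 2) * intensity m LZero + - b / ((a + b) / 2) * intensity m LPi
     + ((\<Sum>h\<in>(UNIV :: 'g set). 0) - 0)
     + ((\<Sum>h\<in>UNIV. - (b * b) * (H.spectrum m h * H.B h \<gamma>)) - - (b * b) * (H.spectrum m 0 * H.B 0 \<gamma>))"
    unfolding fs_indicator_eq
    by (rule trans[OF sum_I[where \<phi> = "\<lambda>h. 0"
          and \<psi> = "\<lambda>h. - (b * b) * (H.spectrum m h * H.B h \<gamma>)"]])
      (simp_all add: intensity(3-5) H.B_minus_left algebra_simps add_divide_distrib diff_divide_distrib)
  also have "\<dots> = X m - (if nmul m \<gamma> = 0 then q2 \<gamma> ^ m else 0)"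
    unfolding sum_distrib_left[symmetric] sum_spectrum H.spectrum_0 intensity
      divide_first_row X_def complex_cnj_add H.B_zero mult_1_right sum.neutral_const
    by (rule indicator_identities[OF aan bbn])
  finally show ?thesis .
qed

section \<open>Fusion coefficients\<close>

lemma LK_in_index: "LK k \<epsilon> \<in> I \<longleftrightarrow> k \<in> two_torsion \<and> k \<noteq> 0 \<and> \<epsilon> \<in> {1, - 1}"
  by (auto simp: index_set_def J1_def)

lemma LG_in_index: "LG g \<in> I \<longleftrightarrow> g \<in> Gs"
  and LGamma_in_index: "LGamma \<gamma> \<in> I \<longleftrightarrow> \<gamma> \<in> Hs"
  and LPi_in_index: "LPi \<in> I"
  by (auto simp: index_set_def)

lemma Gs_not_torsion: "g \<in> Gs \<Longrightarrow> g \<notin> two_torsion"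
  and Hs_nonzero: "\<gamma> \<in> Hs \<Longrightarrow> \<gamma> \<noteq> 0"
  using half_G half_H by (auto simp: half_system_def)

lemma N3_cube: "N3 c q1 q2 Gs Hs x x x = (\<Sum>w\<in>I. S w x ^ 3 / S LZero w)"
  by (simp add: N3_def S_mat_eq power3_eq_cube)

lemma torsion_B:
  assumes "k \<in> two_torsion"
  shows "cnj (G.B h k) = G.B h k" "G.B h k ^ 2 = 1"
proof -
  show r: "cnj (G.B h k) = G.B h k"
    using G.B_minus_right[of h k] two_torsion_minus[OF assms] by simp
  have "G.B h k * cnj (G.B h k) = 1"
    by (metis complex_norm_square G.norm_B of_real_1 power_one)
  then show "G.B h k ^ 2 = 1"
    by (simp add: r power2_eq_square)
qed

lemma sum_B_multiple:
  "(\<Sum>h\<in>UNIV. G.B h g) = n * of_bool (g = 0)"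
  "(\<Sum>h\<in>UNIV. G.B h g ^ m) = n * of_bool (nmul m g = 0)"
  "(\<Sum>h\<in>UNIV. H.B h \<gamma>) = (n + 1) * of_bool (\<gamma> = 0)"
  "(\<Sum>h\<in>UNIV. H.B h \<gamma> ^ m) = (n + 1) * of_bool (nmul m \<gamma> = 0)"
  by (simp_all add: G.sum_B H.sum_B G.B_nmul(2)[symmetric] H.B_nmul(2)[symmetric] n_def card add.commute)

lemma N3_LZero: "N3 c q1 q2 Gs Hs LZero LZero LZero = 1"
proof -
  have cube: "z ^ 3 / z = z * z" for z :: complex
    by (simp add: power3_eq_cube)
  have "N3 c q1 q2 Gs Hs LZero LZero LZero
      = ((a - b) / 2) ^ 3 / ((a - b) / 2) + ((a + b) / 2) ^ 3 / ((a + b) / 2)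
      + ((\<Sum>h\<in>(UNIV :: 'g set). a * a / 2) - a * a / 2)
      + ((\<Sum>h\<in>(UNIV :: 'h set). b * b / 2) - b * b / 2)"
    unfolding N3_cube
    by (rule trans[OF sum_I[where \<phi> = "\<lambda>_. a * a / 2" and \<psi> = "\<lambda>_. b * b / 2"]])
      (simp_all add: power3_eq_cube)
  also have "\<dots> = 1"
    unfolding cube using fusion_identities(1)[OF aan bbn] by (simp add: n_def[symmetric] card add.commute)
  finally show ?thesis .
qed

text \<open>The values found here and for the other labels are the third indicators in the case
  \<open>X 3 = 4\<close>.\<close>

lemma N3_LPi: "N3 c q1 q2 Gs Hs LPi LPi LPi = 4"
proof -
  have "N3 c q1 q2 Gs Hs LPi LPi LPi
      = ((a + b) / 2) ^ 3 / ((a - b) / 2) + ((a - b) / 2) ^ 3 / ((a + b) / 2)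
      + ((\<Sum>h\<in>(UNIV :: 'g set). a * a / 2) - a * a / 2)
      + ((\<Sum>h\<in>(UNIV :: 'h set). - (b * b) / 2) - - (b * b) / 2)"
    unfolding N3_cube
    by (rule trans[OF sum_I[where \<phi> = "\<lambda>_. a * a / 2" and \<psi> = "\<lambda>_. - (b * b) / 2"]])
      (simp_all add: power3_eq_cube)
  also have "\<dots> = 4"
    unfolding divide_first_row
    using fusion_identities(2)[OF aan bbn] by (simp add: n_def[symmetric] card add.commute)
  finally show ?thesis .
qed

lemma N3_LG:
  assumes g: "g \<in> Gs"
  shows "N3 c q1 q2 Gs Hs (LG g) (LG g) (LG g) = 4 + of_bool (nmul 3 g = 0)"
proof -
  \<comment> \<open>At a 2-torsion \<open>k\<close> the pairing is 1 or -1. The two signs together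
    contribute \<open>4 * G.B k g\<close>, which therefore has the common form
    \<open>G.B k g ^ 3 + 3 * G.B k g\<close>.\<close>
  have cube: "G.B k g ^ 3 = G.B k g" if "k \<in> two_torsion" for k
    using torsion_B(2)[OF that, of g] by (simp add: power3_eq_cube power2_eq_square G.B_commute)
  have add_cnj: "(z + cnj z) ^ 3 = z ^ 3 + 3 * z + (cnj z ^ 3 + 3 * cnj z)" if "z * cnj z = 1" for z
    using that by algebra
  have unit: "G.B h g * cnj (G.B h g) = 1" for h
    by (metis complex_norm_square G.norm_B of_real_1 power_one)
  have "N3 c q1 q2 Gs Hs (LG g) (LG g) (LG g)
      = a ^ 3 / ((a - b) / 2) + a ^ 3 / ((a + b) / 2)
      + ((\<Sum>h\<in>UNIV. a * a * (G.B h g ^ 3 + 3 * G.B h g)) - a * a * (G.B 0 g ^ 3 + 3 * G.B 0 g))"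
    unfolding N3_cube
  proof (rule trans[OF sum_I[where \<phi> = "\<lambda>h. a * a * (G.B h g ^ 3 + 3 * G.B h g)" and \<psi> = "\<lambda>_. 0"]])
    show "S (LG h) (LG g) ^ 3 / S LZero (LG h) = a * a * (G.B h g ^ 3 + 3 * G.B h g)
        + a * a * (G.B (- h) g ^ 3 + 3 * G.B (- h) g)" for h
      by (simp add: power_mult_distrib add_cnj[OF unit] G.B_minus_left) (simp add: power3_eq_cube field_simps)
    show "S (LK k 1) (LG g) ^ 3 / S LZero (LK k 1) + S (LK k (- 1)) (LG g) ^ 3 / S LZero (LK k (- 1))
       = a * a * (G.B k g ^ 3 + 3 * G.B k g)" if "k \<in> two_torsion" for k
      by (simp add: power_mult_distrib cube[OF that]) (simp add: power3_eq_cube)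
  qed simp_all
  \<comment> \<open>The cubes sum to the 3-torsion indicator, while the linear part vanishes because
    \<open>g\<close> is nonzero.\<close>
  also have "(\<Sum>h\<in>UNIV. a * a * (G.B h g ^ 3 + 3 * G.B h g)) - a * a * (G.B 0 g ^ 3 + 3 * G.B 0 g)
      = a * a * (n * of_bool (nmul 3 g = 0)) - 4 * (a * a)"
    unfolding sum_distrib_left[symmetric] sum.distrib sum_B_multiple
    using Gs_not_torsion[OF g] by auto
  also have "a ^ 3 / ((a - b) / 2) + a ^ 3 / ((a + b) / 2) + \<dots> = 4 + of_bool (nmul 3 g = 0)"
    unfolding divide_first_row by (rule fusion_identities[OF aan bbn])
  finally show ?thesis .
qed

lemma N3_LGamma:
  assumes g: "\<gamma> \<in> Hs"
  shows "N3 c q1 q2 Gs Hs (LGamma \<gamma>) (LGamma \<gamma>) (LGamma \<gamma>) = 4 - of_bool (nmul 3 \<gamma> = 0)"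
proof -
  have add_cnj: "(z + cnj z) ^ 3 = z ^ 3 + 3 * z + (cnj z ^ 3 + 3 * cnj z)" if "z * cnj z = 1" for z
    using that by algebra
  have unit: "H.B h \<gamma> * cnj (H.B h \<gamma>) = 1" for h
    by (metis complex_norm_square H.norm_B of_real_1 power_one)
  have "N3 c q1 q2 Gs Hs (LGamma \<gamma>) (LGamma \<gamma>) (LGamma \<gamma>)
      = b ^ 3 / ((a - b) / 2) + (- b) ^ 3 / ((a + b) / 2)
      + ((\<Sum>h\<in>UNIV. - (b * b) * (H.B h \<gamma> ^ 3 + 3 * H.B h \<gamma>)) - - (b * b) * (H.B 0 \<gamma> ^ 3 + 3 * H.B 0 \<gamma>))"
    unfolding N3_cube
  proof (rule trans[OF sum_I[where \<psi> = "\<lambda>h. - (b * b) * (H.B h \<gamma> ^ 3 + 3 * H.B h \<gamma>)" and \<phi> = "\<lambda>_. 0"]])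
    show "S (LGamma h) (LGamma \<gamma>) ^ 3 / S LZero (LGamma h) = - (b * b) * (H.B h \<gamma> ^ 3 + 3 * H.B h \<gamma>)
        + - (b * b) * (H.B (- h) \<gamma> ^ 3 + 3 * H.B (- h) \<gamma>)" for h
      by (simp add: power_mult_distrib add_cnj[OF unit] H.B_minus_left) (simp add: power3_eq_cube field_simps)
  qed simp_all
  also have "(\<Sum>h\<in>UNIV. - (b * b) * (H.B h \<gamma> ^ 3 + 3 * H.B h \<gamma>)) - - (b * b) * (H.B 0 \<gamma> ^ 3 + 3 * H.B 0 \<gamma>)
      = - (b * b) * ((n + 1) * of_bool (nmul 3 \<gamma> = 0)) + 4 * (b * b)"
    unfolding sum_distrib_left[symmetric] sum.distrib sum_B_multiple
    using Hs_nonzero[OF g] by auto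
  also have "b ^ 3 / ((a - b) / 2) + (- b) ^ 3 / ((a + b) / 2) + \<dots> = 4 - of_bool (nmul 3 \<gamma> = 0)"
    unfolding divide_first_row by (rule fusion_identities[OF aan bbn])
  finally show ?thesis .
qed

lemma N3_LK:
  assumes c: "c ^ 2 = 1" and k: "LK k \<epsilon> \<in> I"
  shows "N3 c q1 q2 Gs Hs (LK k \<epsilon>) (LK k \<epsilon>) (LK k \<epsilon>) = 2"
proof -
  have k: "k \<in> two_torsion" "k \<noteq> 0" and e: "\<epsilon> ^ 2 = 1"
    using k by (auto simp: LK_in_index)
  \<comment> \<open>The extra 3/2 at \<open>h = k\<close> comes from the cross terms in the cubes of
    \<open>(a * p + t) / 2\<close> and \<open>(a * p - t) / 2\<close>, where
    \<open>t ^ 2 = p\<close> relies on \<open>c ^ 2 = 1\<close>.\<close>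
  let ?\<phi> = "\<lambda>h. a * a / 2 * G.B h k + 3 / 2 * of_bool (h = k)"
  have cube: "G.B h k ^ 3 = G.B h k" for h
    using torsion_B(2)[OF k(1), of h] by (simp add: power3_eq_cube power2_eq_square)
  have "N3 c q1 q2 Gs Hs (LK k \<epsilon>) (LK k \<epsilon>) (LK k \<epsilon>)
      = (a / 2) ^ 3 / ((a - b) / 2) + (a / 2) ^ 3 / ((a + b) / 2)
      + (sum ?\<phi> UNIV - ?\<phi> 0)"
    unfolding N3_cube
  proof (rule trans[OF sum_I[where \<phi> = ?\<phi> and \<psi> = "\<lambda>_. 0"]])
    fix g assume g: "g \<in> Gs"
    then have "g \<noteq> k" "- g \<noteq> k"
      using k Gs_not_torsion[OF g] two_torsion_minus[OF k(1)] by auto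
    then show "S (LG g) (LK k \<epsilon>) ^ 3 / S LZero (LG g) = ?\<phi> g + ?\<phi> (- g)"
      by (simp add: power_mult_distrib cube G.B_minus_left torsion_B[OF k(1)]) (simp add: power3_eq_cube)
  next
    fix h :: 'g
    show "S (LK h 1) (LK k \<epsilon>) ^ 3 / S LZero (LK h 1) + S (LK h (- 1)) (LK k \<epsilon>) ^ 3 / S LZero (LK h (- 1))
        = ?\<phi> h"
    proof (cases "h = k")
      case False
      then show ?thesis
        by (simp add: power_mult_distrib power_divide cube) (simp add: power3_eq_cube)
    next
      case True
      define p t where "p = G.B k k" and "t = c * \<epsilon> * q1 k"
      have t: "t ^ 2 = p"
        by (simp add: t_def p_def power_mult_distrib c e G.q_square)
      have p: "p ^ 2 = 1"
        by (simp add: p_def torsion_B(2)[OF k(1)])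
      have "(a * p + t) ^ 3 + (a * p - t) ^ 3 = 2 * a * (a * a * p * p ^ 2 + 3 * (p * t ^ 2))"
        by (simp add: power3_eq_cube power2_eq_square algebra_simps)
      also have "\<dots> = 2 * a * (a * a * p + 3)"
        unfolding t using p by (simp add: power2_eq_square)
      finally have "(a * p + t) ^ 3 + (a * p - t) ^ 3 = 2 * a * (a * a * p + 3)" .
      then have "((a * p + t) / 2) ^ 3 / (a / 2) + ((a * p - t) / 2) ^ 3 / (a / 2) = a * a / 2 * p + 3 / 2"
        by (simp add: power_divide add_divide_distrib[symmetric])
      then show ?thesis
        using True by (simp add: p_def t_def mult_ac)
    qed
  qed simp_all
  also have "\<dots> = 2"
    unfolding divide_first_row sum.distrib sum_distrib_left[symmetric] sum_B_multiple
    using fusion_identities(3)[OF aan bbn] k(2) by simp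
  finally show ?thesis .
qed

end

section \<open>The conditions on the second and third indicators\<close>

lemma cube_roots_of_unity:
  "exp (2 * of_real pi * \<i> / 3) = Complex (- 1 / 2) (sqrt 3 / 2)"
  "exp (4 * of_real pi * \<i> / 3) = Complex (- 1 / 2) (- sqrt 3 / 2)"
proof -
  have eq: "2 * pi / 3 = pi - pi / 3" "4 * pi / 3 = pi + pi / 3"
    by simp_all
  have "cos (2 * pi / 3) = - 1 / 2" "sin (2 * pi / 3) = sqrt 3 / 2"
    "cos (4 * pi / 3) = - 1 / 2" "sin (4 * pi / 3) = - sqrt 3 / 2"
    unfolding eq cos_add sin_add cos_diff sin_diff by (simp_all add: cos_60 sin_60)
  then have "cis (2 * pi / 3) = Complex (- 1 / 2) (sqrt 3 / 2)"
    "cis (4 * pi / 3) = Complex (- 1 / 2) (- sqrt 3 / 2)"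
    by (simp_all add: complex_eq_iff)
  then show "exp (2 * of_real pi * \<i> / 3) = Complex (- 1 / 2) (sqrt 3 / 2)"
    "exp (4 * of_real pi * \<i> / 3) = Complex (- 1 / 2) (- sqrt 3 / 2)"
    by (simp_all add: cis_conv_exp mult_ac)
qed

text \<open>The only real sums of two cube roots of unity are \<open>1 + 1\<close> and the sum -1 of
  the two nontrivial ones; nonnegativity excludes the latter.\<close>

lemma two_cube_roots_of_unity_sum:
  assumes "x \<in> {1, exp (2 * of_real pi * \<i> / 3), exp (4 * of_real pi * \<i> / 3)}"
    and "y \<in> {1, exp (2 * of_real pi * \<i> / 3), exp (4 * of_real pi * \<i> / 3)}"
    and "x + y = of_real r" "r \<ge> 0"
  shows "r = 2"
  using assms unfolding cube_roots_of_unity by (auto simp: complex_eq_iff)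

locale klein_modular_pair = modular_pair q1 q2 Gs Hs c
  for q1 :: "'g::{finite,ab_group_add} \<Rightarrow> complex"
    and q2 :: "'h::{finite,ab_group_add} \<Rightarrow> complex" and Gs Hs c +
  assumes klein: "card (two_torsion :: 'g set) = 4"
    and c_eq: "c = - gauss q2 1"
begin

text \<open>A nonzero element equal to its negative would lie both in \<open>Hs\<close> and in its
  disjoint mirror image.\<close>

lemma no_two_torsion:
  fixes x :: 'h
  assumes "x + x = 0"
  shows "x = 0"
proof (rule ccontr)
  assume "x \<noteq> 0"
  then have "x \<in> Hs \<or> x \<in> uminus ` Hs" "Hs \<inter> uminus ` Hs = {}"
    using half_H by (auto simp: half_system_def)
  moreover have "- x = x"
    using assms by (simp add: neg_eq_iff_add_eq_0)
  ultimately show False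
    by (metis disjoint_iff image_iff minus_minus)
qed

text \<open>A subgroup of order 4 forces \<open>|\<Gamma>| \<equiv> 1 (mod 4)\<close>, where the quadratic Gauss sum is \<open>\<plusminus>1\<close>.\<close>
lemma c_square: "c ^ 2 = 1"
proof -
  have "4 dvd CARD('g)"
    using card_two_torsion_dvd[where 'g = 'g] klein by simp
  then have "CARD('h) mod 4 = 1"
    using card by presburger
  then show ?thesis
    using H.gauss_1_square_eq_1[OF no_two_torsion] c_eq by simp
qed

text \<open>Both the self-duality of this label and its second indicator are thus governed by
  \<open>q1 k ^ 2\<close>.\<close>

lemma invol_LK: "invol c q1 (LK k \<epsilon>) = (LK k (q1 k ^ 2 * \<epsilon>) :: ('g, 'h) label)"
  by (simp add: c_square G.q_square)

lemma nontrivial_torsion: "\<exists>k :: 'g. k \<in> two_torsion \<and> k \<noteq> 0"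
proof (rule ccontr)
  assume "\<not> ?thesis"
  then have "(two_torsion :: 'g set) \<subseteq> {0}" by auto
  from card_mono[OF _ this] klein show False by simp
qed

lemma FS2_iff: "FS2 c q1 q2 Gs Hs \<longleftrightarrow> cmod (gauss q1 2 + gauss q2 2) = 1"
proof
  assume "FS2 c q1 q2 Gs Hs"
  \<comment> \<open>The label \<open>LPi\<close> is self-dual and its indicator is a squared
    modulus, so the value -1 is impossible.\<close>
  then have "X 2 \<in> {1, - 1}"
    unfolding FS2_def using LPi_in_index by (metis fs_LPi invol.simps(3))
  then have "of_real ((cmod (gauss q1 2 + gauss q2 2))\<^sup>2) \<in> {of_real 1, of_real (- 1) :: complex}"
    unfolding X_eq by simp
  then have "(cmod (gauss q1 2 + gauss q2 2))\<^sup>2 \<in> {1, - 1}"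
    unfolding insert_iff of_real_eq_iff by blast
  then have "(cmod (gauss q1 2 + gauss q2 2))\<^sup>2 = 1"
    using zero_le_power2[of "cmod (gauss q1 2 + gauss q2 2)"] by (auto simp del: zero_le_power2)
  then show "cmod (gauss q1 2 + gauss q2 2) = 1"
    using norm_ge_zero[of "gauss q1 2 + gauss q2 2"] by (auto simp: power2_eq_1_iff simp del: norm_ge_zero)
next
  assume "cmod (gauss q1 2 + gauss q2 2) = 1"
  then have X: "X 2 = 1"
    using X_eq[of 2] by simp
  show "FS2 c q1 q2 Gs Hs"
    unfolding FS2_def
  proof
    fix x :: "('g, 'h) label"
    assume x: "x \<in> I"
    show "(x \<noteq> invol c q1 x \<longrightarrow> fs_indicator c q1 q2 Gs Hs 2 x = 0) \<and>
      (x = invol c q1 x \<longrightarrow> fs_indicator c q1 q2 Gs Hs 2 x \<in> {1, - 1})"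
    proof (cases x)
      case (LK k \<epsilon>)
      then have k: "k \<in> two_torsion" and e: "\<epsilon> \<noteq> 0"
        using x by (auto simp: LK_in_index)
      have fs: "fs_indicator c q1 q2 Gs Hs 2 x = (1 + q1 k ^ 2) / 2"
        using k by (simp add: LK fs_LK X two_torsion_def)
      \<comment> \<open>The value 1 fixes the label and gives the indicator 1; the value -1 flips
        the nonzero sign and gives the indicator 0.\<close>
      have "q1 k ^ 2 = 1 \<or> q1 k ^ 2 = - 1"
        using torsion_B(2)[OF k, of k] by (simp add: G.q_square power2_eq_1_iff)
      then show ?thesis
        unfolding fs unfolding LK invol_LK using e by auto
    next
      case (LG g)
      then have "nmul 2 g \<noteq> 0"
        using x Gs_not_torsion by (auto simp: LG_in_index two_torsion_def)
      then show ?thesis by (simp add: LG fs_LG X)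
    next
      case (LGamma \<gamma>)
      then have "nmul 2 \<gamma> \<noteq> 0"
        using x Hs_nonzero no_two_torsion[of \<gamma>] by (auto simp: LGamma_in_index numeral_2_eq_2)
      then show ?thesis by (simp add: LGamma fs_LGamma X)
    qed (simp_all add: fs_LZero fs_LPi X)
  qed
qed

lemma FS3_iff: "FS3 c q1 q2 Gs Hs \<longleftrightarrow> cmod (gauss q1 3 + gauss q2 3) = 2"
proof
  assume FS3: "FS3 c q1 q2 Gs Hs"
  obtain k :: 'g where k: "k \<in> two_torsion" "k \<noteq> 0"
    using nontrivial_torsion by blast
  let ?x = "LK k 1 :: ('g, 'h) label"
  have x: "?x \<in> I"
    using k by (simp add: LK_in_index)
  obtain m \<omega> where m: "N3 c q1 q2 Gs Hs ?x ?x ?x = of_nat m"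
    and \<omega>: "\<forall>i<m. \<omega> i \<in> {1, exp (2 * of_real pi * \<i> / 3), exp (4 * of_real pi * \<i> / 3)}"
    and fs: "fs_indicator c q1 q2 Gs Hs 3 ?x = (\<Sum>i<m. \<omega> i)"
    using FS3 x unfolding FS3_def by blast
  have "of_nat m = (of_nat 2 :: complex)"
    using m N3_LK[OF c_square x] by simp
  then have m: "m = 2"
    using of_nat_eq_iff by blast
  \<comment> \<open>For 2-torsion \<open>k\<close> the triple is \<open>k\<close> itself, so the
    torsion term vanishes and the indicator is the nonnegative real \<open>X 3 / 2\<close>.\<close>
  have "nmul 3 k \<noteq> 0"
    using k by (simp add: two_torsion_def numeral_2_eq_2 numeral_3_eq_3)
  then have "(\<Sum>i<m. \<omega> i) = X 3 / 2"
    unfolding fs[symmetric] by (simp add: fs_LK[OF k(1)])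
  moreover have "(\<Sum>i<m. \<omega> i) = \<omega> 0 + \<omega> 1"
    by (simp add: m numeral_2_eq_2)
  ultimately have "\<omega> 0 + \<omega> 1 = of_real ((cmod (gauss q1 3 + gauss q2 3))\<^sup>2 / 2)"
    using X_eq[of 3] by simp
  moreover have "0 < m" "1 < m"
    using m by simp_all
  ultimately have "(cmod (gauss q1 3 + gauss q2 3))\<^sup>2 / 2 = 2"
    using two_cube_roots_of_unity_sum \<omega> by (metis divide_nonneg_pos zero_le_power2 zero_less_numeral)
  then have "(cmod (gauss q1 3 + gauss q2 3))\<^sup>2 = 2\<^sup>2"
    by simp
  then show "cmod (gauss q1 3 + gauss q2 3) = 2"
    by (rule power2_eq_imp_eq) simp_all
next
  assume "cmod (gauss q1 3 + gauss q2 3) = 2"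
  then have X: "X 3 = 4"
    using X_eq[of 3] by simp
  \<comment> \<open>Each third indicator equals the number of summands, so all roots can be chosen
    to be 1.\<close>
  have "\<exists>m. N3 c q1 q2 Gs Hs x x x = of_nat m \<and> fs_indicator c q1 q2 Gs Hs 3 x = of_nat m"
    if x: "x \<in> I" for x
  proof (cases x)
    case LZero
    then show ?thesis by (intro exI[of _ 1]) (simp add: N3_LZero fs_LZero)
  next
    case LPi
    then show ?thesis by (intro exI[of _ 4]) (simp add: N3_LPi fs_LPi X)
  next
    case (LK k \<epsilon>)
    then have k: "k \<in> two_torsion" "k \<noteq> 0"
      using x by (auto simp: LK_in_index)
    then have "nmul 3 k \<noteq> 0"
      by (simp add: two_torsion_def numeral_2_eq_2 numeral_3_eq_3)
    then show ?thesis
      using N3_LK[OF c_square, of k \<epsilon>] x k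
      by (intro exI[of _ 2]) (simp add: LK fs_LK X)
  next
    case (LG g)
    then show ?thesis
      using N3_LG[of g] x G.torsion_three[of g]
      by (intro exI[of _ "4 + of_bool (nmul 3 g = 0)"]) (auto simp: LG_in_index fs_LG X)
  next
    case (LGamma \<gamma>)
    then show ?thesis
      using N3_LGamma[of \<gamma>] x H.torsion_three[of \<gamma>]
      \<comment> \<open>The subtraction of natural numbers is exact, since \<open>of_bool\<close> is
        at most 1.\<close>
      by (intro exI[of _ "4 - of_bool (nmul 3 \<gamma> = 0)"]) (auto simp: LGamma_in_index fs_LGamma X)
  qed
  then show "FS3 c q1 q2 Gs Hs"
    unfolding FS3_def by (metis (no_types, lifting) insertCI lessThan_iff sum.cong sum_constant card_lessThan mult.right_neutral)
qed

end

theorem lemma6p8: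
  fixes q1 :: "'g::{finite,ab_group_add} \<Rightarrow> complex"
    and q2 :: "'h::{finite,ab_group_add} \<Rightarrow> complex"
    and Gs :: "'g set" and \<Gamma>s :: "'h set" and c :: complex
  assumes "metric_group q1" and "metric_group q2"
    and "even CARD('g)" and "odd CARD('h)"
    and "c = gauss q1 1" and "c = - gauss q2 1"
    and "CARD('h) = CARD('g) + 1"
    and "is_klein_four (two_torsion :: 'g set)"
    and "half_system two_torsion Gs" and "half_system {0} \<Gamma>s"
  shows "(\<forall>m. fs_indicator c q1 q2 Gs \<Gamma>s m LPi = of_real ((cmod (gauss q1 m + gauss q2 m))\<^sup>2)) \<and>
    (\<forall>m. \<forall>(k, \<epsilon>)\<in>J1. fs_indicator c q1 q2 Gs \<Gamma>s m (LK k \<epsilon>) =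
       (of_real ((cmod (gauss q1 m + gauss q2 m))\<^sup>2) + (if nmul m k = 0 then q1 k ^ m else 0)) / 2) \<and>
    (\<forall>m. \<forall>g\<in>Gs. fs_indicator c q1 q2 Gs \<Gamma>s m (LG g) =
       of_real ((cmod (gauss q1 m + gauss q2 m))\<^sup>2) + (if nmul m g = 0 then q1 g ^ m else 0)) \<and>
    (\<forall>m. \<forall>\<gamma>\<in>\<Gamma>s. fs_indicator c q1 q2 Gs \<Gamma>s m (LGamma \<gamma>) =
       of_real ((cmod (gauss q1 m + gauss q2 m))\<^sup>2) - (if nmul m \<gamma> = 0 then q2 \<gamma> ^ m else 0)) \<and>
    (FS2 c q1 q2 Gs \<Gamma>s \<longleftrightarrow> cmod (gauss q1 2 + gauss q2 2) = 1) \<and>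
    (FS3 c q1 q2 Gs \<Gamma>s \<longleftrightarrow> cmod (gauss q1 3 + gauss q2 3) = 2)"
proof -
  interpret klein_modular_pair q1 q2 Gs \<Gamma>s c
    by unfold_locales (use assms card_klein_four in auto)
  show ?thesis
    unfolding X_eq FS2_iff FS3_iff fs_LPi fs_LG fs_LGamma
    by (auto simp: J1_def fs_LK)
qed

end
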